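(* Let $\lambda:\mathbb{R}^+\to\mathbb{R}^+$ be any locally integrable function with $\int_0^\infty\lambda=\infty$, and let $T^\lambda$ be the P$^\lambda$WIT. Then the following dichotomy holds. (i) If either there exists some $t>0$ such that $\int_0^t\lambda=0$, or there exists some $C>0$ such that $\int_0^x\lambda\le C^x$ for all $x\in\mathbb{R}^+$, then there exists $\alpha>0$ such that $$\lim_{n\to\infty}\frac{m_n(T^\lambda)}{n}=\alpha$$ almost surely. In particular, $T^\lambda$ has linear growth almost surely. Furthermore, for each $K>0$ there exists $\delta>0$ such that (for every $n\ge 1$) $$\mathbb{P}\left(m_n(T^\lambda)<\delta n\right)\le e^{-Kn}.$$ (ii) Otherwise, $T^\lambda$ does not have linear growth, almost surely.
   Context: For a locally integrable $\lambda:\mathbb{R}^+\to\mathbb{R}^+$ with $\int_0^\infty\lambda=\infty$, the inhomogeneous Poisson point process $P^\lambda$ is the point process on the positive real line such that for each pair of disjoint intervals $[a,b],[c,d]$: $|P^\lambda\cap[a,b]|$ has Poisson distribution with mean $\int_a^b\lambda$, and $|P^\lambda\cap[a,b]|$, $|P^\lambda\cap[c,d]|$ are independent. $P^\lambda(j)$ denotes the position of its $j$th smallest particle. Let $\mathbb{N}^{<\omega}$ be the set of finite sequences of natural numbers ($\mathbb{N}=\{1,2,\dots\}$); for $\mathbf{i}\in\mathbb{N}^{<\omega}$ and $j\in\mathbb{N}$, $\mathbf{i}j$ is the sequence obtained by appending $j$ at the right end of $\mathbf{i}$. The P$^\lambda$WIT $T^\lambda$ is the randomly weighted rooted tree with vertex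 set $\mathbb{N}^{<\omega}$, root $\emptyset$, edge set $\{\{\mathbf{i},\mathbf{i}j\}:\mathbf{i}\in\mathbb{N}^{<\omega},\,j\ge1\}$, where independent copies $P^\lambda_{\mathbf{i}}$ of $P^\lambda$ are associated to the vertices $\mathbf{i}$ and the edge $\{\mathbf{i},\mathbf{i}j\}$ has weight $P^\lambda_{\mathbf{i}}(j)$. For a rooted tree $T$ with edge weights, $m_n(T)$ denotes the minimum (infimum, if not attained) over all paths from the root to a node of the $n$th generation (a node at distance $n$ from the root) of the sum of the weights of the edges on the path. $T$ has (exhibits) linear growth if $\liminf_{n\to\infty} m_n(T)/n>0$. *)

theory Defs
  imports "HOL-Probability.Probability"
begin

section \<open>Inhomogeneous Poisson point processes\<close>

definition count :: "real set \<Rightarrow> real \<times> real \<Rightarrow> nat" where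
  "count S = (\<lambda>(a, b). card (S \<inter> {a..b}))"

text \<open>
  The space of counting fields \<open>(a, b) \<mapsto> |S \<inter> [a, b]|\<close>. The law of a random point set is
  understood as the law of its counting field on this space.
\<close>

definition count_field_space :: "(real \<times> real \<Rightarrow> nat) measure" where
  "count_field_space = Pi\<^sub>M UNIV (\<lambda>_. count_space UNIV)"

definition point_process :: "'a measure \<Rightarrow> ('a \<Rightarrow> real set) \<Rightarrow> bool" where
  "point_process M N \<longleftrightarrow>
     (\<forall>\<omega>\<in>space M. N \<omega> \<subseteq> {0<..} \<and> (\<forall>b. finite (N \<omega> \<inter> {0..b}))) \<and>
     (\<lambda>\<omega>. count (N \<omega>)) \<in> M \<rightarrow>\<^sub>M count_field_space"

text \<open>
  The Poisson probabilities are written out because \<^const>\<open>poisson_pmf\<close> is only specified for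
  positive rates, while the mean of a count vanishes, e.g., on a degenerate interval. Independence
  is asked for pairs of disjoint intervals only, so every process with completely independent
  increments and the right Poisson counts is covered.
\<close>

definition poisson_process :: "'a measure \<Rightarrow> (real \<Rightarrow> real) \<Rightarrow> ('a \<Rightarrow> real set) \<Rightarrow> bool" where
  "poisson_process M l N \<longleftrightarrow>
     point_process M N \<and>
     (\<forall>a b. 0 \<le> a \<and> a \<le> b \<longrightarrow>
        (\<forall>k. measure M {\<omega> \<in> space M. card (N \<omega> \<inter> {a..b}) = k} =
             (LINT x:{a..b}|lebesgue. l x) ^ k / fact k * exp (- (LINT x:{a..b}|lebesgue. l x)))) \<and>
     (\<forall>a b c d. 0 \<le> a \<and> a \<le> b \<and> 0 \<le> c \<and> c \<le> d \<and> {a..b} \<inter> {c..d} = {} \<longrightarrow>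
        prob_space.indep_var M (count_space UNIV) (\<lambda>\<omega>. card (N \<omega> \<inter> {a..b}))
                               (count_space UNIV) (\<lambda>\<omega>. card (N \<omega> \<inter> {c..d})))"

text \<open>The \<open>j\<close>th smallest element, counting from 1.\<close>

definition nth_particle :: "real set \<Rightarrow> nat \<Rightarrow> real" where
  "nth_particle S j = (THE x. x \<in> S \<and> card {y \<in> S. y \<le> x} = j)"

section \<open>Rooted trees with edge weights\<close>

record 'v weighted_tree =
  tverts :: "'v set"
  troot :: 'v
  tedges :: "'v set set"
  tweight :: "'v set \<Rightarrow> real"

text \<open>Paths are nonempty lists of pairwise distinct vertices.\<close>

definition is_path :: "('v, 'r) weighted_tree_scheme \<Rightarrow> 'v list \<Rightarrow> bool" where
  "is_path T p \<longleftrightarrow> p \<noteq> [] \<and> set p \<subseteq> tverts T \<and> distinct p \<and>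
     successively (\<lambda>u v. {u, v} \<in> tedges T) p"

definition path_weight :: "('v, 'r) weighted_tree_scheme \<Rightarrow> 'v list \<Rightarrow> real" where
  "path_weight T p = (\<Sum>k<length p - 1. tweight T {p ! k, p ! Suc k})"

definition tree_dist :: "('v, 'r) weighted_tree_scheme \<Rightarrow> 'v \<Rightarrow> 'v \<Rightarrow> nat" where
  "tree_dist T u v = (LEAST d. \<exists>p. is_path T p \<and> hd p = u \<and> last p = v \<and> length p = Suc d)"

definition generation :: "('v, 'r) weighted_tree_scheme \<Rightarrow> nat \<Rightarrow> 'v set" where
  "generation T n = {v \<in> tverts T. tree_dist T (troot T) v = n}"

definition min_weight :: "('v, 'r) weighted_tree_scheme \<Rightarrow> nat \<Rightarrow> real" where
  "min_weight T n =
     Inf {path_weight T p | p. is_path T p \<and> hd p = troot T \<and> last p \<in> generation T n}"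

definition linear_growth :: "('v, 'r) weighted_tree_scheme \<Rightarrow> bool" where
  "linear_growth T \<longleftrightarrow> liminf (\<lambda>n. ereal (min_weight T n / real n)) > 0"

section \<open>The Poisson-weighted infinite tree\<close>

definition pwit_verts :: "nat list set" where
  "pwit_verts = lists {1..}"

text \<open>
  The tree determined by one configuration \<open>S i\<close> of particles for each vertex \<open>i\<close>. An edge
  \<open>{i, i @ [j]}\<close> determines \<open>i\<close> (its shorter endpoint) and \<open>j\<close>, hence its weight.
\<close>

definition pwit :: "(nat list \<Rightarrow> real set) \<Rightarrow> nat list weighted_tree" where
  "pwit S = \<lparr> tverts = pwit_verts,
              troot = [],
              tedges = {{i, i @ [j]} | i j. i \<in> pwit_verts \<and> 1 \<le> j},
              tweight = (\<lambda>e. THE w. \<exists>i j. i \<in> pwit_verts \<and> 1 \<le> j \<and> e = {i, i @ [j]} \<and>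
                                          w = nth_particle (S i) j) \<rparr>"

text \<open>
  Independent copies of one Poisson process. Equality of laws is stated separately, as it does not
  follow from pairwise independence of the counts on intervals.
\<close>

definition iid_poisson_processes ::
    "'a measure \<Rightarrow> (real \<Rightarrow> real) \<Rightarrow> (nat list \<Rightarrow> 'a \<Rightarrow> real set) \<Rightarrow> bool" where
  "iid_poisson_processes M l P \<longleftrightarrow>
     (\<forall>i\<in>pwit_verts. poisson_process M l (P i)) \<and>
     (\<forall>i\<in>pwit_verts. \<forall>i'\<in>pwit_verts.
        distr M count_field_space (\<lambda>\<omega>. count (P i \<omega>)) =
        distr M count_field_space (\<lambda>\<omega>. count (P i' \<omega>))) \<and>
     prob_space.indep_vars M (\<lambda>_. count_field_space) (\<lambda>i \<omega>. count (P i \<omega>)) pwit_verts"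

end

theory Submission
  imports Defs
begin

text \<open>
  The tree is a branching random walk. The vertices of generation \<open>n\<close> are the words of length \<open>n\<close>,
  the position of a word is the total weight of the edges on its root path, and
  \<^term>\<open>min_weight\<close> is the smallest position in the generation. The whole argument runs on the
  expected number of words of length \<open>n\<close>, over an alphabet of \<open>J\<close> letters, whose position is at most
  \<open>a\<close>; this is \<open>mean_early J n a\<close> below. Truncating the alphabet turns these expectations into finite
  sums. Since a word
  can be split into a prefix and a word of an independent copy of the tree, the
  quantity is supermultiplicative: the product of its values at \<open>(n, a)\<close> and \<open>(k, b)\<close> is at most its
  value at \<open>(n + k, a + b)\<close>.

  If \<open>mean_early J n a > 1\<close> for some \<open>J\<close>, then the words that progress by at most \<open>a\<close> in each block of
  \<open>n\<close> letters contain a supercritical Galton--Watson tree. It survives with positive probability, and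
  because the root has infinitely many children with independent subtrees, almost surely it
  survives below one of them. Hence the growth rate is at most \<open>a / n\<close>. Let \<open>\<alpha>\<close> be the infimum of all such
  ratios. For \<open>a < b < \<alpha>\<close> every \<open>mean_early J n (b * n)\<close> is at most \<open>1\<close>; spending the slack
  \<open>(b - a) * n\<close> on a number of additional generations proportional to \<open>n\<close>, in each of which the mean at least
  doubles, shows that \<open>mean_early J n (a * n)\<close> decays exponentially, and Borel--Cantelli bounds the
  growth rate from below by \<open>a\<close>. So the rate is \<open>\<alpha>\<close> whenever \<open>\<alpha> > 0\<close> (\<open>first_passage_speed\<close>).

  The two cases of the dichotomy decide whether \<open>\<alpha>\<close> is positive. Write \<open>\<Lambda>\<close> for the integral of the
  rate function from \<open>0\<close>; by the Poisson hypothesis \<open>\<Lambda> x\<close> is the expected number of edges of weight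
  at most \<open>x\<close> from a vertex to its children. If \<open>\<Lambda>\<close> grows at most exponentially, its Laplace transform is
  finite for large arguments and tends to \<open>0\<close> at infinity, so that Markov's inequality for an exponential moment makes
  \<open>mean_early J n (\<delta> * n)\<close> at most \<open>exp (- K * n)\<close> for a suitable \<open>\<delta>\<close>. If \<open>\<Lambda>\<close> vanishes at some
  \<open>t > 0\<close>, there are no edges of weight at most \<open>t\<close>, and the same means are \<open>0\<close> for \<open>\<delta> = t\<close>. In the remaining
  case \<open>\<Lambda> x\<close> exceeds \<open>C powr x\<close> for every \<open>C\<close> and a suitable \<open>x\<close>, while arbitrarily short edges
  exist. One long step of length at most \<open>x\<close> gains a factor so large that it pays for the losses of about \<open>x / t\<close>
  short steps of length at most \<open>t\<close>, and these dilute the cost of the long step to a speed of order \<open>t\<close>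
  (\<open>supercritical_at_all_speeds\<close>). So the growth rate is below every \<open>e > 0\<close>.
\<close>

section \<open>Root paths of the tree\<close>

lemma pwit_simps [simp]:
  "tverts (pwit S) = pwit_verts" "troot (pwit S) = []"
  "tedges (pwit S) = {{i, i @ [j]} | i j. i \<in> pwit_verts \<and> 1 \<le> j}"
  by (simp_all add: pwit_def)

lemma tweight_pwit:
  assumes "i \<in> pwit_verts" "1 \<le> j"
  shows "tweight (pwit S) {i, i @ [j]} = nth_particle (S i) j"
  using assms unfolding pwit_def by (auto intro!: the_equality simp: doubleton_eq_iff)

text \<open>The path from the root to \<open>v\<close>; by \<open>paths_from_root\<close> it is the only one.\<close>

definition prefix_path :: "nat list \<Rightarrow> nat list list" where
  "prefix_path v = map (\<lambda>k. take k v) [0..<Suc (length v)]"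

lemma length_prefix_path [simp]: "length (prefix_path v) = Suc (length v)"
  by (simp add: prefix_path_def)

lemma nth_prefix_path: "k \<le> length v \<Longrightarrow> prefix_path v ! k = take k v"
  by (simp add: prefix_path_def del: upt_Suc)

lemma prefix_path_edge:
  assumes "v \<in> pwit_verts" "k < length v"
  shows "take k v \<in> pwit_verts" "1 \<le> v ! k" "take (Suc k) v = take k v @ [v ! k]"
  using assms nth_mem[of k v] by (auto simp: pwit_verts_def take_Suc_conv_app_nth dest: in_set_takeD)

lemma prefix_path_is_path:
  assumes v: "v \<in> pwit_verts"
  shows "is_path (pwit S) (prefix_path v)"
  unfolding is_path_def successively_conv_nth
proof (intro conjI allI impI)
  show "prefix_path v \<noteq> []" by (simp add: prefix_path_def)
  show "set (prefix_path v) \<subseteq> tverts (pwit S)"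
    using v by (auto simp: prefix_path_def pwit_verts_def dest: in_set_takeD simp del: upt_Suc)
  show "distinct (prefix_path v)"
    unfolding distinct_conv_nth by (auto simp: nth_prefix_path dest!: arg_cong[where f = length])
  fix k assume "Suc k < length (prefix_path v)"
  then have k: "k < length v" by simp
  then show "{prefix_path v ! k, prefix_path v ! Suc k} \<in> tedges (pwit S)"
    using prefix_path_edge[OF v k] by (auto simp: nth_prefix_path)
qed

text \<open>
  A path cannot return to a vertex, so starting at the root it can never step back to a parent: the
  \<open>k\<close>th vertex is a word of length \<open>k\<close> whose parent is the previous vertex. The path is therefore
  determined by its last vertex.
\<close>

lemma path_from_root_is_prefix_path:
  assumes path: "is_path (pwit S) q" and root: "hd q = []"
  shows "q = prefix_path (last q)"
proof -
  have ne: "q \<noteq> []" and dist: "distinct q"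
    and edge: "\<And>k. Suc k < length q \<Longrightarrow> {q ! k, q ! Suc k} \<in> tedges (pwit S)"
    using path by (auto simp: is_path_def successively_conv_nth)
  have q0: "q ! 0 = []" using root ne by (simp add: hd_conv_nth)
  \<comment> \<open>A step towards the root would lead to the parent of \<open>q ! k\<close>, which is already \<open>q ! (k - 1)\<close>.\<close>
  have step: "length (q ! k) = k \<and> (k \<noteq> 0 \<longrightarrow> butlast (q ! k) = q ! (k - 1))" if "k < length q" for k
    using that
  proof (induction k)
    case (Suc k)
    then have IH: "length (q ! k) = k" "k \<noteq> 0 \<Longrightarrow> butlast (q ! k) = q ! (k - 1)" by auto
    from edge[OF Suc.prems] obtain i j where "{q ! k, q ! Suc k} = {i, i @ [j]}" by auto
    then consider "q ! Suc k = q ! k @ [j]" | "q ! k = q ! Suc k @ [j]"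
      by (auto simp: doubleton_eq_iff)
    then show ?case
    proof cases
      case 2
      then have "k \<noteq> 0" using IH(1) by (cases k) auto
      moreover have "butlast (q ! k) = q ! Suc k" using 2 by simp
      ultimately have "q ! (k - 1) = q ! Suc k" using IH(2) by simp
      then show ?thesis
        using dist Suc.prems by (simp add: nth_eq_iff_index_eq)
    qed (use IH in simp)
  qed (simp add: q0)
  have prefix: "q ! (m - i) = take (m - i) (q ! m)" if "m < length q" for m i
  proof (induction i)
    case 0
    then show ?case using step[OF that] by simp
  next
    case (Suc i)
    show ?case
    proof (cases "m - i = 0")
      case True
      then show ?thesis using Suc by simp
    next
      case False
      then have "m - Suc i = m - i - 1" "m - i < length q" using that by auto
      then have "q ! (m - Suc i) = butlast (q ! (m - i))" using step[of "m - i"] False by simp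
      then show ?thesis using Suc False step[OF that] by (simp add: butlast_take)
    qed
  qed
  define m where "m = length q - 1"
  have m: "m < length q" "last q = q ! m" using ne by (auto simp: m_def last_conv_nth)
  have "length (last q) = m" using step[OF m(1)] m(2) by simp
  show ?thesis
  proof (rule nth_equalityI)
    show "length q = length (prefix_path (last q))"
      using \<open>length (last q) = m\<close> ne by (simp add: m_def)
    fix k assume "k < length q"
    then have "k \<le> m" by (simp add: m_def)
    then show "q ! k = prefix_path (last q) ! k"
      using prefix[OF m(1), of "m - k"] \<open>length (last q) = m\<close> m(2) by (simp add: nth_prefix_path)
  qed
qed

lemma last_prefix_path [simp]: "last (prefix_path v) = v"
  by (simp add: prefix_path_def)

lemma hd_prefix_path [simp]: "hd (prefix_path v) = []"
  by (simp add: prefix_path_def hd_map del: upt_Suc)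

lemma paths_from_root:
  "is_path (pwit S) q \<and> hd q = [] \<longleftrightarrow> last q \<in> pwit_verts \<and> q = prefix_path (last q)"
proof
  assume *: "is_path (pwit S) q \<and> hd q = []"
  then have "q \<noteq> []" "set q \<subseteq> pwit_verts" by (auto simp: is_path_def)
  then show "last q \<in> pwit_verts \<and> q = prefix_path (last q)"
    using * path_from_root_is_prefix_path by auto
next
  assume "last q \<in> pwit_verts \<and> q = prefix_path (last q)"
  then show "is_path (pwit S) q \<and> hd q = []"
    by (metis hd_prefix_path prefix_path_is_path)
qed

lemma tree_dist_pwit_root:
  assumes "v \<in> pwit_verts"
  shows "tree_dist (pwit S) [] v = length v"
  unfolding tree_dist_def
proof (rule Least_equality)
  show "\<exists>q. is_path (pwit S) q \<and> hd q = [] \<and> last q = v \<and> length q = Suc (length v)"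
    using prefix_path_is_path[OF assms] by (intro exI[of _ "prefix_path v"]) simp
  fix d assume "\<exists>q. is_path (pwit S) q \<and> hd q = [] \<and> last q = v \<and> length q = Suc d"
  then show "length v \<le> d"
    using path_from_root_is_prefix_path by (metis Suc_inject length_prefix_path order_refl)
qed

lemma generation_pwit: "generation (pwit S) n = {v \<in> pwit_verts. length v = n}"
  by (auto simp: generation_def tree_dist_pwit_root)

lemma path_weight_prefix_path:
  assumes v: "v \<in> pwit_verts"
  shows "path_weight (pwit S) (prefix_path v) = (\<Sum>k<length v. nth_particle (S (take k v)) (v ! k))"
  unfolding path_weight_def
  using prefix_path_edge[OF v] by (intro sum.cong) (auto simp: nth_prefix_path tweight_pwit)

text \<open>
  From here on letters are counted from \<open>0\<close>: the word \<open>w\<close> stands for the vertex \<open>map Suc w\<close>. All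
  words are then admissible, so that product spaces can be indexed by the whole type.
\<close>

lemma min_weight_pwit:
  "min_weight (pwit S) n =
     (INF w\<in>{w. length w = n}. \<Sum>k<length w. nth_particle (S (map Suc (take k w))) (Suc (w ! k)))"
proof -
  let ?V = "{v \<in> pwit_verts. length v = n}"
  have "{path_weight (pwit S) q | q. is_path (pwit S) q \<and> hd q = troot (pwit S) \<and> last q \<in> generation (pwit S) n}
      = (\<lambda>v. path_weight (pwit S) (prefix_path v)) ` ?V"
    unfolding generation_pwit using paths_from_root[of S]
    by (auto simp: image_iff) (metis last_prefix_path)+
  also have "?V = map Suc ` {w. length w = n}"
  proof safe
    fix v :: "nat list" assume "v \<in> pwit_verts" "n = length v"
    then have "v = map Suc (map (\<lambda>j. j - 1) v)"
      by (auto simp: pwit_verts_def intro!: nth_equalityI) (metis Suc_pred in_lists_conv_set nth_mem atLeast_iff less_le_trans zero_less_one One_nat_def)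
    then show "v \<in> map Suc ` {w. length w = length v}"
      by (intro image_eqI[of _ _ "map (\<lambda>j. j - 1) v"]) auto
  qed (auto simp: pwit_verts_def)
  also have "(\<lambda>v. path_weight (pwit S) (prefix_path v)) ` map Suc ` {w. length w = n} =
      (\<lambda>w. \<Sum>k<length w. nth_particle (S (map Suc (take k w))) (Suc (w ! k))) ` {w. length w = n}"
    unfolding image_image
  proof (intro image_cong refl)
    fix w :: "nat list"
    have "map Suc w \<in> pwit_verts" by (auto simp: pwit_verts_def)
    from path_weight_prefix_path[OF this, of S]
    show "path_weight (pwit S) (prefix_path (map Suc w)) =
        (\<Sum>k<length w. nth_particle (S (map Suc (take k w))) (Suc (w ! k)))"
      by (simp add: take_map)
  qed
  finally show ?thesis by (simp add: min_weight_def)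
qed

section \<open>Particle positions as functionals of the counting field\<close>

text \<open>
  The induction passes from \<open>x\<close> to the first particle beyond \<open>x\<close>. It starts at \<open>x = 0\<close>, which is no
  particle, hence the guard \<open>0 < j\<close>.
\<close>

lemma particle_exists:
  fixes S :: "real set"
  assumes S: "S \<subseteq> {0<..}" "\<And>b. finite (S \<inter> {0..b})" "infinite S"
  shows "\<exists>x\<ge>0. card (S \<inter> {0..x}) = j \<and> (0 < j \<longrightarrow> x \<in> S)"
proof (induction j)
  case 0
  have "S \<inter> {0..0} = {}" using S(1) by auto
  then show ?case by (intro exI[of _ 0]) simp
next
  case (Suc j)
  then obtain x where x: "0 \<le> x" "card (S \<inter> {0..x}) = j" by blast
  obtain y where y: "y \<in> S" "x < y"
  proof -
    have "\<not> S \<subseteq> S \<inter> {0..x}" using S(2,3) finite_subset by blast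
    then show ?thesis using S(1) that by force
  qed
  let ?R = "S \<inter> {x<..y}"
  have fin: "finite ?R" by (rule finite_subset[OF _ S(2)[of y]]) (use x in auto)
  define z where "z = Min ?R"
  have z: "z \<in> ?R" unfolding z_def using fin y by (intro Min_in) auto
  have "z \<le> u" if "u \<in> S" "x < u" "u \<le> z" for u
    unfolding z_def using that z fin by (intro Min_le) auto
  then have "S \<inter> {0..z} = insert z (S \<inter> {0..x})"
    using z x by (auto intro: order_antisym)
  then have "card (S \<inter> {0..z}) = Suc j"
    using S(2) x z by simp
  then show ?case using z x by (intro exI[of _ z]) auto
qed

lemma nth_particle_le_iff:
  assumes S: "S \<subseteq> {0<..}" "\<And>b. finite (S \<inter> {0..b})" "infinite S" and j: "0 < j"
  shows "nth_particle S j \<le> x \<longleftrightarrow> j \<le> card (S \<inter> {0..x})"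
proof -
  have eq: "{y \<in> S. y \<le> x} = S \<inter> {0..x}" for x using S(1) by auto
  have less: "card (S \<inter> {0..u}) < card (S \<inter> {0..v})" if "u < v" "v \<in> S" for u v
  proof (rule psubset_card_mono)
    show "S \<inter> {0..u} \<subset> S \<inter> {0..v}" using that S(1) by force
  qed (rule S(2))
  obtain z where z: "z \<in> S" "card (S \<inter> {0..z}) = j"
    using particle_exists[OF S, of j] j by auto
  have "nth_particle S j = z"
    unfolding nth_particle_def eq
  proof (rule the_equality)
    fix u assume "u \<in> S \<and> card (S \<inter> {0..u}) = j"
    then show "u = z" using less[of u z] less[of z u] z by (cases u z rule: linorder_cases) auto
  qed (use z in simp)
  moreover have "j \<le> card (S \<inter> {0..x})" if "z \<le> x"
    using z that S(2) by (auto intro!: card_mono)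
  ultimately show ?thesis using less[of x z] z by (cases "z \<le> x") auto
qed

text \<open>
  The position of the particle number \<open>Suc j\<close>, read off the counting field alone, so that it is
  measurable on the space on which independence and equality of laws are given. Rational radii make the
  infimum countable; the value \<open>\<infinity>\<close> for fields with too few particles becomes \<open>0\<close>.
\<close>

definition particle_position :: "nat \<Rightarrow> (real \<times> real \<Rightarrow> nat) \<Rightarrow> real" where
  "particle_position j c =
     real_of_ereal (INF r\<in>\<rat> \<inter> {0..}. if j < c (0, r) then ereal r else \<infinity>)"

lemma measurable_count_field_component [measurable]:
  "(\<lambda>c. c ab) \<in> count_field_space \<rightarrow>\<^sub>M count_space UNIV"
  unfolding count_field_space_def by measurable

lemma measurable_particle_position [measurable]:
  "particle_position j \<in> borel_measurable count_field_space"
  unfolding particle_position_def[abs_def]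
proof (intro borel_measurable_real_of_ereal borel_measurable_INF)
  show "countable (\<rat> \<inter> {0::real..})" by (intro countable_Int1 countable_rat)
qed measurable

lemma particle_position_nonneg: "0 \<le> particle_position j c"
  unfolding particle_position_def by (intro real_of_ereal_pos INF_greatest) auto

lemma particle_position_count:
  assumes S: "S \<subseteq> {0<..}" "\<And>b. finite (S \<inter> {0..b})" "infinite S"
  shows "particle_position j (Defs.count S) = nth_particle S (Suc j)"
proof -
  define z where "z = nth_particle S (Suc j)"
  have le_iff: "z \<le> x \<longleftrightarrow> j < card (S \<inter> {0..x})" for x
    unfolding z_def Suc_le_eq[symmetric] by (rule nth_particle_le_iff[OF S]) simp
  have z: "0 < z"
  proof -
    have "S \<inter> {0..0} = {}" using S(1) by auto
    then show ?thesis using le_iff[of 0] by simp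
  qed
  have "(INF r\<in>\<rat> \<inter> {0..}. if j < card (S \<inter> {0..r}) then ereal r else \<infinity>) = ereal z" (is "?I = _")
  proof (rule antisym)
    show "?I \<le> ereal z"
    proof (rule dense_ge)
      fix y assume "ereal z < y"
      then obtain x where x: "ereal z < ereal x" "ereal x < y" using ereal_dense2 by blast
      then obtain r where r: "r \<in> \<rat>" "z < r" "r < x" using Rats_dense_in_real by auto
      then have "?I \<le> (if j < card (S \<inter> {0..r}) then ereal r else \<infinity>)"
        using z by (intro INF_lower) auto
      also have "\<dots> = ereal r" using le_iff[of r] r by simp
      also have "\<dots> \<le> ereal x" using r by simp
      also have "\<dots> \<le> y" using x by simp
      finally show "?I \<le> y" .
    qed
    show "ereal z \<le> ?I" by (intro INF_greatest) (auto simp: le_iff)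
  qed
  then show ?thesis by (simp add: particle_position_def Defs.count_def z_def)
qed

section \<open>The cumulative rate\<close>

definition mean_count :: "(real \<Rightarrow> real) \<Rightarrow> real \<Rightarrow> real" where
  "mean_count l x = (LINT s:{0..x}|lebesgue. l s)"

lemma mean_count_nonneg:
  assumes "\<And>x. 0 \<le> x \<Longrightarrow> 0 \<le> l x"
  shows "0 \<le> mean_count l b"
  unfolding mean_count_def set_lebesgue_integral_def
  using assms by (intro Bochner_Integration.integral_nonneg) (auto simp: indicator_def)

lemma mean_count_mono:
  assumes nonneg: "\<And>x. 0 \<le> x \<Longrightarrow> 0 \<le> l x"
    and int: "\<And>x. 0 \<le> x \<Longrightarrow> set_integrable lebesgue {0..x} l" and ab: "0 \<le> a" "a \<le> b"
  shows "mean_count l a \<le> mean_count l b"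
  unfolding mean_count_def set_lebesgue_integral_def
  using int[of a] int[of b] nonneg ab
  by (intro integral_mono) (auto simp: set_integrable_def indicator_def)

text \<open>Dominated convergence along the intervals \<open>{0..1 / n}\<close>, whose limit is the null set \<open>{0}\<close>.\<close>

lemma mean_count_at_0:
  assumes int: "\<And>x. 0 \<le> x \<Longrightarrow> set_integrable lebesgue {0..x} l" and "0 < e"
  shows "\<exists>h>0. mean_count l h \<le> e"
proof -
  have [measurable]: "(\<lambda>s. indicator {0..x} s *\<^sub>R l s) \<in> borel_measurable lebesgue" if "0 \<le> x" for x
    using int[OF that] by (auto simp: set_integrable_def)
  have "(\<lambda>n. LINT s|lebesgue. indicator {0..1 / real (Suc n)} s *\<^sub>R l s)
      \<longlonglongrightarrow> (LINT s|lebesgue. indicator {0} s *\<^sub>R l s)"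
  proof (rule integral_dominated_convergence[where w = "\<lambda>s. \<bar>indicator {0..1} s *\<^sub>R l s\<bar>"])
    show "integrable lebesgue (\<lambda>s. \<bar>indicator {0..1} s *\<^sub>R l s\<bar>)"
      using int[of 1] by (intro integrable_abs) (simp add: set_integrable_def)
    show "AE s in lebesgue. (\<lambda>n. indicator {0..1 / real (Suc n)} s *\<^sub>R l s) \<longlonglongrightarrow> indicator {0} s *\<^sub>R l s"
    proof (intro AE_I2)
      fix s :: real
      show "(\<lambda>n. indicator {0..1 / real (Suc n)} s *\<^sub>R l s) \<longlonglongrightarrow> indicator {0} s *\<^sub>R l s"
      proof (cases "0 < s")
        case True
        then obtain N where "1 / real (Suc N) < s" using nat_approx_posE by blast
        have "eventually (\<lambda>n. indicator {0..1 / real (Suc n)} s *\<^sub>R l s = indicator {0} s *\<^sub>R l s) sequentially"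
          using eventually_ge_at_top[of N]
        proof eventually_elim
          case (elim n)
          then have "1 / real (Suc n) \<le> 1 / real (Suc N)" by (simp add: field_simps)
          then show ?case using \<open>1 / real (Suc N) < s\<close> True by (simp add: indicator_def)
        qed
        then show ?thesis by (rule tendsto_eventually)
      next
        case False
        then show ?thesis by (auto simp: indicator_def)
      qed
    qed
    show "AE s in lebesgue. norm (indicator {0..1 / real (Suc n)} s *\<^sub>R l s) \<le> \<bar>indicator {0..1} s *\<^sub>R l s\<bar>" for n
    proof (intro AE_I2)
      fix s :: real
      have "1 / real (Suc n) \<le> 1" by simp
      then have "s \<le> 1 / real (Suc n) \<Longrightarrow> s \<le> 1" by linarith
      then show "norm (indicator {0..1 / real (Suc n)} s *\<^sub>R l s) \<le> \<bar>indicator {0..1} s *\<^sub>R l s\<bar>"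
        by (auto simp: indicator_def)
    qed
    show "(\<lambda>s. indicator {0} s *\<^sub>R l s) \<in> borel_measurable lebesgue"
      using int[of 0] by (simp add: set_integrable_def)
  qed measurable
  moreover have "(LINT s|lebesgue. indicator {0} s *\<^sub>R l s) = 0"
  proof (rule integral_eq_zero_AE)
    have "AE s in lebesgue. s \<noteq> (0::real)"
      by (rule AE_completion[OF AE_lborel_singleton])
    then show "AE s in lebesgue. indicator {0} s *\<^sub>R l s = 0"
      by eventually_elim (simp add: indicator_def)
  qed
  ultimately have "(\<lambda>n. mean_count l (1 / real (Suc n))) \<longlonglongrightarrow> 0"
    by (simp add: mean_count_def set_lebesgue_integral_def)
  from order_tendstoD(2)[OF this \<open>0 < e\<close>] obtain n where "mean_count l (1 / real (Suc n)) < e"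
    by (auto simp: eventually_sequentially)
  then show ?thesis by (intro exI[of _ "1 / real (Suc n)"]) auto
qed

lemma mean_count_unbounded:
  assumes nonneg: "\<And>x. 0 \<le> x \<Longrightarrow> 0 \<le> l x"
    and int: "\<And>x. 0 \<le> x \<Longrightarrow> set_integrable lebesgue {0..x} l"
    and inf: "(\<integral>\<^sup>+ x \<in> {0..}. ennreal (l x) \<partial>lebesgue) = \<infinity>"
  shows "filterlim (mean_count l) at_top at_top"
proof -
  have ex: "\<exists>n::nat. r < mean_count l n" for r
  proof (rule ccontr)
    assume "\<nexists>n::nat. r < mean_count l n"
    then have le: "mean_count l n \<le> r" for n :: nat by (auto simp: not_less)
    let ?f = "\<lambda>n x. ennreal (indicator {0..real n} x *\<^sub>R l x)"
    have "(\<integral>\<^sup>+ x \<in> {0..}. ennreal (l x) \<partial>lebesgue) = (\<integral>\<^sup>+ x. (SUP n. ?f n x) \<partial>lebesgue)"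
    proof (intro nn_integral_cong)
      fix x :: real
      show "ennreal (l x) * indicator {0..} x = (SUP n. ?f n x)"
      proof (cases "0 \<le> x")
        case True
        obtain n :: nat where "x \<le> n" using real_arch_simple by blast
        then have "ennreal (l x) \<le> (SUP n. ?f n x)"
          using True by (intro SUP_upper2[of n]) (auto simp: indicator_def)
        moreover have "(SUP n. ?f n x) \<le> ennreal (l x)"
          by (intro SUP_least) (auto simp: indicator_def)
        ultimately show ?thesis using True by (auto intro: antisym)
      qed (simp add: indicator_def)
    qed
    also have "\<dots> = (SUP n. \<integral>\<^sup>+ x. ?f n x \<partial>lebesgue)"
    proof (rule nn_integral_monotone_convergence_SUP)
      show "incseq ?f"
        using nonneg by (auto simp: incseq_def le_fun_def indicator_def intro!: ennreal_leI)
      show "?f n \<in> borel_measurable lebesgue" for n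
        using int[of n] by (intro measurable_compose[OF _ measurable_ennreal]) (auto simp: set_integrable_def)
    qed
    also have "\<dots> \<le> ennreal r"
    proof (rule SUP_least)
      fix n
      have "(\<integral>\<^sup>+ x. ?f n x \<partial>lebesgue) = ennreal (mean_count l n)"
        unfolding mean_count_def set_lebesgue_integral_def
        using int[of n] nonneg by (intro nn_integral_eq_integral) (auto simp: set_integrable_def indicator_def)
      then show "(\<integral>\<^sup>+ x. ?f n x \<partial>lebesgue) \<le> ennreal r" using le[of n] by (simp add: ennreal_leI)
    qed
    finally show False using inf by (simp add: top_unique)
  qed
  show ?thesis
    unfolding filterlim_at_top eventually_at_top_linorder
  proof
    fix r
    from ex[of r] obtain n :: nat where "r < mean_count l n" ..
    then show "\<exists>N. \<forall>x\<ge>N. r \<le> mean_count l x"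
      using mean_count_mono[OF nonneg int, of n] by (intro exI[of _ "real n"]) force
  qed
qed

section \<open>Particles of a Poisson process\<close>

lemma poisson_prob:
  assumes "poisson_process M l N" "0 \<le> b"
  shows "measure M {\<omega> \<in> space M. card (N \<omega> \<inter> {0..b}) = k} =
    mean_count l b ^ k / fact k * exp (- mean_count l b)"
  using assms unfolding poisson_process_def mean_count_def by blast

lemma measurable_card_particles:
  assumes "poisson_process M l N"
  shows "(\<lambda>\<omega>. card (N \<omega> \<inter> {0..b})) \<in> M \<rightarrow>\<^sub>M count_space UNIV"
proof -
  have "(\<lambda>\<omega>. Defs.count (N \<omega>)) \<in> M \<rightarrow>\<^sub>M count_field_space"
    using assms by (simp add: poisson_process_def point_process_def)
  from measurable_compose[OF this measurable_count_field_component[of "(0, b)"]]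
  show ?thesis by (simp add: Defs.count_def)
qed

text \<open>
  The probability of fewer than \<open>k\<close> particles in \<open>{0..b}\<close> is a polynomial in the mean count, divided
  by its exponential, and so tends to \<open>0\<close> as \<open>b\<close> grows.
\<close>

lemma AE_infinite_particles:
  assumes "prob_space M" and N: "poisson_process M l N"
    and unbounded: "filterlim (mean_count l) at_top at_top"
  shows "AE \<omega> in M. infinite (N \<omega>)"
proof -
  interpret prob_space M by fact
  note [measurable] = measurable_card_particles[OF N]
  have few: "AE \<omega> in M. \<exists>b::nat. k \<le> card (N \<omega> \<inter> {0..b})" for k
  proof -
    let ?A = "\<lambda>b. {\<omega> \<in> space M. card (N \<omega> \<inter> {0..b}) < k}"
    have eq: "prob (?A b) = (\<Sum>i<k. mean_count l b ^ i / exp (mean_count l b) / fact i)"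
      if "0 \<le> b" for b
    proof -
      have "prob (?A b) = prob (\<Union>i<k. {\<omega> \<in> space M. card (N \<omega> \<inter> {0..b}) = i})"
        by (rule arg_cong[where f = prob]) auto
      also have "\<dots> = (\<Sum>i<k. prob {\<omega> \<in> space M. card (N \<omega> \<inter> {0..b}) = i})"
        by (intro finite_measure_finite_Union) (auto simp: disjoint_family_on_def)
      finally show ?thesis
        by (simp add: poisson_prob[OF N that] exp_minus divide_inverse mult_ac)
    qed
    have "((\<lambda>b. \<Sum>i<k. mean_count l b ^ i / exp (mean_count l b) / fact i) \<longlongrightarrow> (\<Sum>i<k. 0 / fact i)) at_top"
      by (intro tendsto_sum tendsto_divide tendsto_const filterlim_compose[OF tendsto_power_div_exp_0 unbounded]) auto
    then have lim: "((\<lambda>b. \<Sum>i<k. mean_count l b ^ i / exp (mean_count l b) / fact i) \<longlongrightarrow> 0) at_top"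
      by simp
    have le: "prob {\<omega> \<in> space M. \<forall>b::nat. card (N \<omega> \<inter> {0..b}) < k}
        \<le> (\<Sum>i<k. mean_count l (real b) ^ i / exp (mean_count l (real b)) / fact i)" for b
      by (subst eq[symmetric]) (auto intro!: finite_measure_mono)
    have "prob {\<omega> \<in> space M. \<forall>b::nat. card (N \<omega> \<inter> {0..b}) < k} \<le> 0"
      by (rule LIMSEQ_le_const[OF filterlim_compose[OF lim filterlim_real_sequentially]]) (use le in auto)
    then have "prob {\<omega> \<in> space M. \<forall>b::nat. card (N \<omega> \<inter> {0..b}) < k} = 0"
      by (simp add: measure_le_0_iff)
    then have "AE \<omega> in M. \<omega> \<notin> {\<omega> \<in> space M. \<forall>b::nat. card (N \<omega> \<inter> {0..b}) < k}"
      by (subst (asm) prob_eq_0) auto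
    then show ?thesis by (rule AE_mp) (auto simp: not_less)
  qed
  have "AE \<omega> in M. \<forall>k. \<exists>b::nat. k \<le> card (N \<omega> \<inter> {0..b})"
    using few by (simp add: AE_all_countable)
  then show ?thesis
  proof (rule AE_mp, intro AE_I2 impI notI)
    fix \<omega> assume *: "\<forall>k. \<exists>b::nat. k \<le> card (N \<omega> \<inter> {0..b})" "finite (N \<omega>)"
    then obtain b :: nat where "Suc (card (N \<omega>)) \<le> card (N \<omega> \<inter> {0..b})" by blast
    moreover have "card (N \<omega> \<inter> {0..b}) \<le> card (N \<omega>)" using * by (intro card_mono) auto
    ultimately show False by simp
  qed
qed

text \<open>
  Both sides are the expected number of particles in \<open>{0..b}\<close>: the tail probabilities of a natural
  number valued variable add up to its mean, and the mean of a Poisson variable is its parameter.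
\<close>

lemma poisson_tail_probs_sum:
  assumes "prob_space M" and N: "poisson_process M l N" and b: "0 \<le> b" "0 \<le> mean_count l b"
  shows "(\<lambda>j. measure M {\<omega> \<in> space M. j < card (N \<omega> \<inter> {0..b})}) sums mean_count l b"
proof -
  interpret prob_space M by fact
  note [measurable] = measurable_card_particles[OF N]
  define \<mu> where "\<mu> = mean_count l b"
  let ?C = "\<lambda>\<omega>. card (N \<omega> \<inter> {0..b})"
  have "(\<lambda>k. (\<mu> ^ k / fact k) * (\<mu> * exp (- \<mu>))) sums (exp \<mu> * (\<mu> * exp (- \<mu>)))"
    using exp_converges[of \<mu>] by (intro sums_mult2) (simp add: field_simps)
  then have "(\<lambda>k. real (Suc k) * (\<mu> ^ Suc k / fact (Suc k) * exp (- \<mu>))) sums \<mu>"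
    by (simp add: exp_minus field_simps del: of_nat_Suc)
  then have mean: "(\<lambda>k. real k * (\<mu> ^ k / fact k * exp (- \<mu>))) sums \<mu>"
    by (subst (asm) sums_Suc_iff) simp
  have "(\<Sum>j. emeasure M {\<omega> \<in> space M. j < ?C \<omega>}) = (\<integral>\<^sup>+\<omega>. of_nat (?C \<omega>) \<partial>M)"
    by (rule nn_integral_nat_function[symmetric]) measurable
  also have "\<dots> = (\<integral>\<^sup>+k. of_nat k \<partial>distr M (count_space UNIV) ?C)"
    by (subst nn_integral_distr) auto
  also have "\<dots> = (\<integral>\<^sup>+k. of_nat k * emeasure M {\<omega> \<in> space M. ?C \<omega> = k} \<partial>count_space UNIV)"
  proof -
    have "distr M (count_space UNIV) ?C = density (count_space UNIV) (\<lambda>k. emeasure M {\<omega> \<in> space M. ?C \<omega> = k})"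
    proof (rule measure_eqI_countable[of _ UNIV])
      fix k
      have "emeasure (distr M (count_space UNIV) ?C) {k} = emeasure M {\<omega> \<in> space M. ?C \<omega> = k}"
        by (subst emeasure_distr) (auto intro!: arg_cong[where f = "emeasure M"])
      then show "emeasure (distr M (count_space UNIV) ?C) {k} =
         emeasure (density (count_space UNIV) (\<lambda>k. emeasure M {\<omega> \<in> space M. ?C \<omega> = k})) {k}"
        by (simp add: emeasure_density nn_integral_count_space_indicator)
    qed auto
    then show ?thesis by (simp add: nn_integral_density mult.commute)
  qed
  also have "\<dots> = (\<Sum>k. of_nat k * emeasure M {\<omega> \<in> space M. ?C \<omega> = k})"
    by (rule nn_integral_count_space_nat)
  also have "\<dots> = (\<Sum>k. ennreal (real k * (\<mu> ^ k / fact k * exp (- \<mu>))))"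
    using b by (intro suminf_cong)
       (simp add: emeasure_eq_measure poisson_prob[OF N b(1)] \<mu>_def ennreal_of_nat_eq_real_of_nat flip: ennreal_mult')
  also have "\<dots> = ennreal \<mu>"
    using mean b by (intro suminf_ennreal_eq) (auto simp: \<mu>_def)
  finally have sum: "(\<Sum>j. ennreal (prob {\<omega> \<in> space M. j < ?C \<omega>})) = ennreal \<mu>"
    by (simp add: emeasure_eq_measure)
  then have "summable (\<lambda>j. prob {\<omega> \<in> space M. j < ?C \<omega>})"
    by (intro summable_suminf_not_top) auto
  moreover from this sum have "ennreal (\<Sum>j. prob {\<omega> \<in> space M. j < ?C \<omega>}) = ennreal \<mu>"
    by (subst suminf_ennreal2[symmetric]) auto
  then have "(\<Sum>j. prob {\<omega> \<in> space M. j < ?C \<omega>}) = \<mu>"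
    using b by (subst (asm) ennreal_inj) (auto intro!: suminf_nonneg calculation simp: \<mu>_def)
  ultimately show ?thesis by (simp add: sums_iff \<mu>_def)
qed

lemma poisson_particles:
  assumes "poisson_process M l N" "\<omega> \<in> space M"
  shows "N \<omega> \<subseteq> {0<..}" "finite (N \<omega> \<inter> {0..b})"
  using assms by (auto simp: poisson_process_def point_process_def)

lemma poisson_particle_position_tail:
  assumes "prob_space M" and N: "poisson_process M l N"
    and unbounded: "filterlim (mean_count l) at_top at_top"
  shows "measure M {\<omega> \<in> space M. particle_position j (Defs.count (N \<omega>)) \<le> c} =
    measure M {\<omega> \<in> space M. j < card (N \<omega> \<inter> {0..c})}"
proof -
  interpret prob_space M by fact
  note [measurable] = measurable_card_particles[OF N]
  have [measurable]: "(\<lambda>\<omega>. Defs.count (N \<omega>)) \<in> M \<rightarrow>\<^sub>M count_field_space"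
    using N by (simp add: poisson_process_def point_process_def)
  show ?thesis
  proof (rule finite_measure_eq_AE)
    show "AE \<omega> in M. (\<omega> \<in> {\<omega> \<in> space M. particle_position j (Defs.count (N \<omega>)) \<le> c}) =
        (\<omega> \<in> {\<omega> \<in> space M. j < card (N \<omega> \<inter> {0..c})})"
      using AE_infinite_particles[OF assms]
    proof (rule AE_mp, intro AE_I2 impI)
      fix \<omega> assume \<omega>: "\<omega> \<in> space M" "infinite (N \<omega>)"
      note good = poisson_particles[OF N \<omega>(1)] \<omega>(2)
      show "(\<omega> \<in> {\<omega> \<in> space M. particle_position j (Defs.count (N \<omega>)) \<le> c}) =
        (\<omega> \<in> {\<omega> \<in> space M. j < card (N \<omega> \<inter> {0..c})})"
        using nth_particle_le_iff[OF good, of "Suc j" c] \<omega>(1)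
        by (simp add: particle_position_count[OF good] Suc_le_eq)
    qed
  qed measurable
qed

section \<open>Finite sets of words\<close>

definition shift :: "nat list \<Rightarrow> (nat list \<Rightarrow> 'b) \<Rightarrow> nat list \<Rightarrow> 'b" where
  "shift v y = (\<lambda>u. y (v @ u))"

definition words :: "nat \<Rightarrow> nat \<Rightarrow> nat list set" where
  "words J n = {w. set w \<subseteq> {..<J} \<and> length w = n}"

lemma finite_words [simp]: "finite (words J n)"
  unfolding words_def by (rule finite_lists_length_eq) simp

lemma sum_words_append:
  "(\<Sum>w\<in>words J (n + k). f w) = (\<Sum>u\<in>words J n. \<Sum>v\<in>words J k. f (u @ v))"
proof -
  have "(\<Sum>u\<in>words J n. \<Sum>v\<in>words J k. f (u @ v)) = (\<Sum>(u, v)\<in>words J n \<times> words J k. f (u @ v))"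
    by (simp add: sum.cartesian_product)
  also have "\<dots> = (\<Sum>w\<in>words J (n + k). f w)"
  proof (rule sum.reindex_bij_witness[of _ "\<lambda>w. (take n w, drop n w)" "\<lambda>(u, v). u @ v"])
  qed (auto simp: words_def dest: in_set_takeD in_set_dropD)
  finally show ?thesis by simp
qed

lemma sum_words_1: "(\<Sum>w\<in>words J (Suc 0). f w) = (\<Sum>j<J. f [j])"
  by (rule sum.reindex_bij_witness[of _ "\<lambda>j. [j]" hd])
     (auto simp: words_def length_Suc_conv)

lemma words_mono: "J \<le> J' \<Longrightarrow> words J n \<subseteq> words J' n"
  by (auto simp: words_def)

section \<open>A Bonferroni bound, a quadratic recursion, and reindexed independence\<close>

text \<open>
  The second order Bonferroni bound with a common bound \<open>c\<close> for all pairwise intersections. The number of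
  pairs is generously replaced by the square of the number of events.
\<close>

lemma (in prob_space) bonferroni_pairs:
  assumes "finite W" and D: "\<And>w. w \<in> W \<Longrightarrow> D w \<in> events"
    and pair: "\<And>v w. v \<in> W \<Longrightarrow> w \<in> W \<Longrightarrow> v \<noteq> w \<Longrightarrow> prob (D v \<inter> D w) \<le> c" and c: "0 \<le> c"
  shows "(\<Sum>w\<in>W. prob (D w)) - (real (card W))\<^sup>2 * c \<le> prob (\<Union>w\<in>W. D w)"
  using assms(1) D pair
proof (induction W rule: finite_induct)
  case empty
  then show ?case by simp
next
  case (insert x W)
  have [measurable]: "D x \<in> events" "(\<Union>w\<in>W. D w) \<in> events"
    using insert.prems insert.hyps by auto
  have "prob (D x \<inter> (\<Union>w\<in>W. D w)) = prob (\<Union>w\<in>W. D x \<inter> D w)"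
    by (rule arg_cong[where f = prob]) auto
  also have "\<dots> \<le> (\<Sum>w\<in>W. prob (D x \<inter> D w))"
    using insert by (intro finite_measure_subadditive_finite) auto
  also have "\<dots> \<le> (\<Sum>w\<in>W. c)"
    using insert by (intro sum_mono) auto
  finally have *: "prob (D x \<inter> (\<Union>w\<in>W. D w)) \<le> card W * c" by simp
  have "prob (\<Union>w\<in>insert x W. D w) = prob (D x) + prob (\<Union>w\<in>W. D w) - prob (D x \<inter> (\<Union>w\<in>W. D w))"
    by (simp add: measure_Un3 fmeasurable_eq_sets)
  moreover have "(\<Sum>w\<in>W. prob (D w)) - (real (card W))\<^sup>2 * c \<le> prob (\<Union>w\<in>W. D w)"
    using insert by auto
  moreover have "(real (card (insert x W)))\<^sup>2 * c \<ge> (real (card W))\<^sup>2 * c + card W * c"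
    using insert.hyps c by (simp add: power2_eq_square algebra_simps)
  ultimately show ?case using insert.hyps *
    by simp
qed

text \<open>
  For \<open>x < (m - 1) / C\<close> the map \<open>x \<mapsto> m * x - C * x\<^sup>2\<close> does not decrease \<open>x\<close>. So as soon as the
  decreasing sequence gets below that threshold, it is constant.
\<close>

lemma supercritical_recursion_bounded_below:
  fixes q :: "nat \<Rightarrow> real"
  assumes dec: "\<And>k. q (Suc k) \<le> q k" and pos: "\<And>k. 0 < q k"
    and rec: "\<And>k. m * q k - C * (q k)\<^sup>2 \<le> q (Suc k)" and m: "1 < m" and C: "0 < C"
  shows "\<exists>e>0. \<forall>k. e \<le> q k"
proof (cases "\<forall>k. (m - 1) / C \<le> q k")
  case True
  then show ?thesis using m C by (intro exI[of _ "(m - 1) / C"]) auto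
next
  case False
  then obtain k0 where k0: "q k0 < (m - 1) / C" by (auto simp: not_le)
  have anti: "decseq q" using dec by (auto simp: decseq_Suc_iff)
  have ge: "q k0 \<le> q (k0 + i)" for i
  proof (induction i)
    case (Suc i)
    let ?x = "q (k0 + i)"
    have "?x \<le> q k0" using anti by (auto simp: decseq_def)
    then have "C * ?x \<le> C * q k0" using C by simp
    also have "\<dots> \<le> m - 1" using k0 C by (simp add: field_simps)
    finally have "C * ?x \<le> m - 1" .
    then have "?x * 1 \<le> ?x * (m - C * ?x)" using pos[of "k0 + i"] by (intro mult_left_mono) auto
    also have "\<dots> \<le> q (Suc (k0 + i))" using rec[of "k0 + i"] by (simp add: algebra_simps power2_eq_square)
    finally show ?case using Suc by simp
  qed simp
  have "q k0 \<le> q k" for k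
  proof (cases "k0 \<le> k")
    case True
    then show ?thesis using ge[of "k - k0"] by simp
  next
    case False
    then show ?thesis using anti by (auto simp: decseq_def)
  qed
  then show ?thesis using pos by blast
qed

lemma (in prob_space) indep_sets_reindex:
  assumes indep: "indep_sets F (f ` I)" and inj: "inj_on f I"
  shows "indep_sets (\<lambda>i. F (f i)) I"
proof (rule indep_setsI)
  show "F (f i) \<subseteq> events" if "i \<in> I" for i
    using indep that by (auto simp: indep_sets_def)
next
  fix A J assume J: "J \<noteq> {}" "J \<subseteq> I" "finite J" "\<forall>j\<in>J. A j \<in> F (f j)"
  define A' where "A' = (\<lambda>k. A (inv_into I f k))"
  have A': "A' (f j) = A j" if "j \<in> J" for j
    using that J inj by (auto simp: A'_def)
  have inj_J: "inj_on f J" using inj J(2) by (rule inj_on_subset)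
  have "prob (\<Inter>k\<in>f ` J. A' k) = (\<Prod>k\<in>f ` J. prob (A' k))"
    using J A' by (intro indep_setsD[OF indep]) auto
  then show "prob (\<Inter>j\<in>J. A j) = (\<Prod>j\<in>J. prob (A j))"
    using A' inj_J by (simp add: prod.reindex)
qed

section \<open>Branching random walks on an independent environment\<close>

text \<open>
  Each word carries an independent sample of the law \<open>\<nu>\<close>, and the child \<open>j\<close> of a word is displaced from its parent by
  \<open>X j\<close> of the sample at the parent. The displacements of siblings may depend on each other in any
  way.
\<close>

locale branching_random_walk = offspring: prob_space \<nu>
  for \<nu> :: "'b measure" +
  fixes X :: "nat \<Rightarrow> 'b \<Rightarrow> real"
  assumes measurable_X [measurable]: "X j \<in> borel_measurable \<nu>"
    and X_nonneg: "0 \<le> X j x"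
begin

definition environment :: "(nat list \<Rightarrow> 'b) measure" where
  "environment = Pi\<^sub>M UNIV (\<lambda>_. \<nu>)"

definition position :: "nat list \<Rightarrow> (nat list \<Rightarrow> 'b) \<Rightarrow> real" where
  "position w y = (\<Sum>k<length w. X (w ! k) (y (take k w)))"

sublocale prob_space environment
  unfolding environment_def by (rule prob_space_PiM) (rule offspring.prob_space_axioms)

text \<open>The events that depend on the samples at the words in \<open>K\<close> only.\<close>

definition coordinate_sigma :: "nat list set \<Rightarrow> (nat list \<Rightarrow> 'b) measure" where
  "coordinate_sigma K = sigma (space environment) (\<Union>u\<in>K. {(\<lambda>y. y u) -` A \<inter> space environment |A. A \<in> sets \<nu>})"

lemma space_coordinate_sigma [simp]: "space (coordinate_sigma K) = space environment"
  unfolding coordinate_sigma_def by (rule space_measure_of) auto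

lemma sets_coordinate_sigma:
  "sets (coordinate_sigma K) =
     sigma_sets (space environment) (\<Union>u\<in>K. {(\<lambda>y. y u) -` A \<inter> space environment |A. A \<in> sets \<nu>})"
  unfolding coordinate_sigma_def by (rule sets_measure_of) auto

lemma measurable_coordinate [measurable]: "(\<lambda>y. y u) \<in> environment \<rightarrow>\<^sub>M \<nu>"
  unfolding environment_def by measurable

lemma coordinate_in_space: "y \<in> space environment \<Longrightarrow> y u \<in> space \<nu>"
  using measurable_coordinate[THEN measurable_space] by simp

lemma measurable_coordinate_sigma:
  assumes "u \<in> K"
  shows "(\<lambda>y. y u) \<in> coordinate_sigma K \<rightarrow>\<^sub>M \<nu>"
proof (rule measurableI)
  show "(\<lambda>y. y u) -` A \<inter> space (coordinate_sigma K) \<in> sets (coordinate_sigma K)" if "A \<in> sets \<nu>" for A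
    unfolding sets_coordinate_sigma using assms that by (intro sigma_sets.Basic) auto
qed (auto intro: coordinate_in_space)

lemma indep_coordinates: "indep_vars (\<lambda>_. \<nu>) (\<lambda>u y. y u) UNIV"
proof -
  have 1: "distr environment \<nu> (\<lambda>y. y u) = \<nu>" for u
    unfolding environment_def by (rule distr_PiM_component) (auto intro: offspring.prob_space_axioms)
  have 2: "distr environment (Pi\<^sub>M UNIV (\<lambda>_. \<nu>)) (\<lambda>y. \<lambda>u\<in>UNIV. y u) = environment"
    by (simp add: environment_def restrict_def distr_id)
  show ?thesis
    by (subst indep_vars_iff_distr_eq_PiM) (auto simp: 1 2, simp add: environment_def)
qed

lemma indep_coordinate_sigma:
  assumes "disjoint_family_on K L"
  shows "indep_sets (\<lambda>j. sets (coordinate_sigma (K j))) L"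
proof -
  have "indep_sets (\<lambda>u. {(\<lambda>y. y u) -` A \<inter> space environment |A. A \<in> sets \<nu>}) UNIV"
    using indep_coordinates unfolding indep_vars_def2 by simp
  then have "indep_sets (\<lambda>u. {(\<lambda>y. y u) -` A \<inter> space environment |A. A \<in> sets \<nu>}) (\<Union>j\<in>L. K j)"
    by (rule indep_sets_mono_index[rotated]) simp
  then show ?thesis
    unfolding sets_coordinate_sigma
  proof (rule indep_sets_collect_sigma)
    show "Int_stable {(\<lambda>y. y i) -` A \<inter> space environment |A. A \<in> sets \<nu>}" for i
    proof (rule Int_stableI, safe)
      fix A B assume "A \<in> sets \<nu>" "B \<in> sets \<nu>"
      then show "\<exists>C. (\<lambda>y. y i) -` A \<inter> space environment \<inter> ((\<lambda>y. y i) -` B \<inter> space environment) =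
          (\<lambda>y. y i) -` C \<inter> space environment \<and> C \<in> sets \<nu>"
        by (intro exI[of _ "A \<inter> B"]) auto
    qed
  qed (use assms in auto)
qed

lemma sets_coordinate_sigma_subset: "sets (coordinate_sigma K) \<subseteq> events"
  unfolding sets_coordinate_sigma
  by (rule sets.sigma_sets_subset) (auto intro!: measurable_sets[OF measurable_coordinate])

lemma measurable_coordinate_sigma_mono:
  "f \<in> coordinate_sigma K \<rightarrow>\<^sub>M N \<Longrightarrow> f \<in> environment \<rightarrow>\<^sub>M N"
  using sets_coordinate_sigma_subset[of K] by (auto simp: measurable_def)

lemma prob_Int_disjoint:
  assumes "K \<inter> K' = {}" "Measurable.pred (coordinate_sigma K) A" "Measurable.pred (coordinate_sigma K') B"
  shows "prob {y \<in> space environment. A y \<and> B y} = prob {y \<in> space environment. A y} * prob {y \<in> space environment. B y}"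
proof -
  let ?K = "\<lambda>b. if b then K else K'"
  let ?A = "\<lambda>b. {y \<in> space environment. if b then A y else B y}"
  have "prob (\<Inter>b\<in>UNIV. ?A b) = (\<Prod>b\<in>UNIV. prob (?A b))"
  proof (rule indep_setsD[OF indep_coordinate_sigma[of ?K UNIV]])
    show "disjoint_family_on ?K UNIV" using assms(1) by (auto simp: disjoint_family_on_def)
    show "\<forall>b\<in>UNIV. ?A b \<in> sets (coordinate_sigma (?K b))"
      using assms(2,3)[THEN predE] by auto
  qed auto
  moreover have "(\<Inter>b\<in>UNIV. ?A b) = {y \<in> space environment. A y \<and> B y}"
    by (auto split: if_splits)
  ultimately show ?thesis by (simp add: UNIV_bool mult.commute)
qed

lemma measurable_shift_coordinate_sigma [measurable]:
  "shift v \<in> coordinate_sigma (range ((@) v)) \<rightarrow>\<^sub>M environment"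
  unfolding environment_def
proof (rule measurable_PiM_single')
  show "(\<lambda>y. shift v y i) \<in> coordinate_sigma (range ((@) v)) \<rightarrow>\<^sub>M \<nu>" for i
    unfolding shift_def by (rule measurable_coordinate_sigma) auto
  show "shift v \<in> space (coordinate_sigma (range ((@) v))) \<rightarrow> UNIV \<rightarrow>\<^sub>E space \<nu>"
    by (auto simp: shift_def intro: coordinate_in_space)
qed

lemma measurable_shift [measurable]: "shift v \<in> environment \<rightarrow>\<^sub>M environment"
  by (rule measurable_coordinate_sigma_mono[OF measurable_shift_coordinate_sigma])

text \<open>The shift reindexes a product of equal factors along the injection \<open>u \<mapsto> v @ u\<close>.\<close>

lemma distr_shift: "distr environment environment (shift v) = environment"
proof -
  have "distr (Pi\<^sub>M UNIV (\<lambda>_. \<nu>)) (\<Pi>\<^sub>M i\<in>UNIV. \<nu>) (\<lambda>y. \<lambda>u\<in>UNIV. y (v @ u)) = (\<Pi>\<^sub>M i\<in>UNIV. \<nu>)"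
    by (rule distr_PiM_reindex) (auto simp: inj_on_def offspring.prob_space_axioms)
  then show ?thesis by (simp add: environment_def shift_def[abs_def] restrict_def)
qed

lemma prob_shift:
  assumes [measurable]: "Measurable.pred environment A"
  shows "prob {y \<in> space environment. A (shift v y)} = prob {y \<in> space environment. A y}"
proof -
  have "prob {y \<in> space environment. A y} = measure (distr environment environment (shift v)) {y \<in> space environment. A y}"
    by (simp add: distr_shift)
  also have "\<dots> = prob {y \<in> space environment. A (shift v y)}"
    using measurable_shift[of v, THEN measurable_space]
    by (subst measure_distr) (auto intro!: arg_cong[where f = prob])
  finally show ?thesis by simp
qed

lemma position_Nil [simp]: "position [] y = 0"
  by (simp add: position_def)

lemma position_snoc: "position (w @ [j]) y = position w y + X j (y w)"
  by (simp add: position_def nth_append)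

lemma position_append: "position (u @ v) y = position u y + position v (shift u y)"
  by (induction v rule: rev_induct) (simp_all add: position_snoc shift_def flip: append_assoc)

lemma position_nonneg [simp]: "0 \<le> position w y"
  by (simp add: position_def sum_nonneg X_nonneg)

lemma position_measurable_coordinate_sigma:
  assumes "length w \<le> n"
  shows "position w \<in> borel_measurable (coordinate_sigma {u. length u < n})"
  unfolding position_def
proof (intro borel_measurable_sum)
  fix k assume "k \<in> {..<length w}"
  then have "(\<lambda>y. y (take k w)) \<in> coordinate_sigma {u. length u < n} \<rightarrow>\<^sub>M \<nu>"
    using assms by (intro measurable_coordinate_sigma) auto
  then show "(\<lambda>y. X (w ! k) (y (take k w))) \<in> borel_measurable (coordinate_sigma {u. length u < n})"
    by measurable
qed

lemma position_measurable [measurable]: "position w \<in> borel_measurable environment"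
  by (rule measurable_coordinate_sigma_mono[OF position_measurable_coordinate_sigma[OF order_refl]])

definition early_prob :: "nat list \<Rightarrow> real \<Rightarrow> real" where
  "early_prob w a = prob {y \<in> space environment. position w y \<le> a}"

text \<open>By linearity, the expected number of words of length \<open>n\<close> over \<open>J\<close> letters that are at a position of at most \<open>a\<close>.\<close>

definition mean_early :: "nat \<Rightarrow> nat \<Rightarrow> real \<Rightarrow> real" where
  "mean_early J n a = (\<Sum>w\<in>words J n. early_prob w a)"

lemma early_prob_nonneg [simp]: "0 \<le> early_prob w a"
  by (simp add: early_prob_def)

lemma mean_early_nonneg [simp]: "0 \<le> mean_early J n a"
  by (simp add: mean_early_def sum_nonneg)

lemma mean_early_mono_index: "J \<le> J' \<Longrightarrow> mean_early J n a \<le> mean_early J' n a"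
  unfolding mean_early_def by (rule sum_mono2) (auto simp: words_mono[THEN subsetD])

lemma early_prob_mono: "a \<le> b \<Longrightarrow> early_prob w a \<le> early_prob w b"
  unfolding early_prob_def by (rule finite_measure_mono) auto

lemma mean_early_mono: "a \<le> b \<Longrightarrow> mean_early J n a \<le> mean_early J n b"
  unfolding mean_early_def by (rule sum_mono) (rule early_prob_mono)

text \<open>
  The branching property: the position of \<open>w\<close> depends on the samples at proper prefixes of \<open>w\<close>, and
  the subtree of \<open>w\<close> on the samples at extensions of \<open>w\<close>.
\<close>

lemma prob_prefix_and_shift:
  assumes [measurable]: "Measurable.pred environment A"
  shows "prob {y \<in> space environment. position w y \<le> a \<and> A (shift w y)} = early_prob w a * prob {y \<in> space environment. A y}"
proof -
  have "prob {y \<in> space environment. position w y \<le> a \<and> A (shift w y)} =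
      prob {y \<in> space environment. position w y \<le> a} * prob {y \<in> space environment. A (shift w y)}"
  proof (rule prob_Int_disjoint)
    show "{u. length u < length w} \<inter> range ((@) w) = {}" by auto
    have [measurable]: "position w \<in> borel_measurable (coordinate_sigma {u. length u < length w})"
      by (rule position_measurable_coordinate_sigma) simp
    show "Measurable.pred (coordinate_sigma {u. length u < length w}) (\<lambda>y. position w y \<le> a)" by measurable
    show "Measurable.pred (coordinate_sigma (range ((@) w))) (\<lambda>y. A (shift w y))" by measurable
  qed
  then show ?thesis by (simp add: early_prob_def prob_shift)
qed

lemma early_prob_append: "early_prob u a * early_prob v b \<le> early_prob (u @ v) (a + b)"
proof -
  have "early_prob u a * early_prob v b = prob {y \<in> space environment. position u y \<le> a \<and> position v (shift u y) \<le> b}"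
    by (subst prob_prefix_and_shift) (auto simp: early_prob_def)
  also have "\<dots> \<le> early_prob (u @ v) (a + b)"
    unfolding early_prob_def by (rule finite_measure_mono) (auto simp: position_append)
  finally show ?thesis .
qed

lemma mean_early_supermultiplicative: "mean_early J n a * mean_early J k b \<le> mean_early J (n + k) (a + b)"
  unfolding mean_early_def sum_words_append sum_product by (intro sum_mono early_prob_append)

lemma mean_early_0: "0 \<le> a \<Longrightarrow> mean_early J 0 a = 1"
  by (simp add: mean_early_def words_def early_prob_def prob_space cong: conj_cong)

lemma mean_early_power: "0 \<le> a \<Longrightarrow> (mean_early J 1 a) ^ n \<le> mean_early J n (n * a)"
proof (induction n)
  case (Suc n)
  have "mean_early J 1 a ^ Suc n \<le> mean_early J 1 a * mean_early J n (n * a)"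
    using Suc by (simp add: mult_left_mono)
  also have "\<dots> \<le> mean_early J (1 + n) (a + n * a)" by (rule mean_early_supermultiplicative)
  finally show ?case by (simp add: algebra_simps)
qed (simp add: mean_early_0)

section \<open>Survival of a supercritical subtree\<close>

text \<open>
  Survival for \<open>k\<close> generations of the embedded Galton--Watson tree in which the children of a word are its
  extensions by those words of \<open>W\<close> that advance by at most \<open>a\<close>.
\<close>

primrec lineage :: "nat list set \<Rightarrow> real \<Rightarrow> nat \<Rightarrow> (nat list \<Rightarrow> 'b) \<Rightarrow> bool" where
  "lineage W a 0 y = True"
| "lineage W a (Suc k) y = (\<exists>w\<in>W. position w y \<le> a \<and> lineage W a k (shift w y))"

lemma measurable_lineage [measurable]:
  "finite W \<Longrightarrow> Measurable.pred environment (lineage W a k)"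
proof (induction k)
  case (Suc k)
  have [measurable]: "Measurable.pred environment (lineage W a k)" using Suc by simp
  have "Measurable.pred environment (\<lambda>y. \<exists>w\<in>W. position w y \<le> a \<and> lineage W a k (shift w y))"
    using Suc.prems by (intro pred_intros_finite) measurable
  then show ?case by simp
next
  case 0
  then show ?case by (simp add: lineage.simps(1)[abs_def])
qed

lemma lineage_antimono: "lineage W a (Suc k) y \<Longrightarrow> lineage W a k y"
  by (induction k arbitrary: y) auto

lemma lineage_word:
  assumes "lineage (words J n) a k y"
  shows "\<exists>w. length w = k * n \<and> position w y \<le> k * a"
  using assms
proof (induction k arbitrary: y)
  case (Suc k)
  then obtain u where u: "u \<in> words J n" "position u y \<le> a" "lineage (words J n) a k (shift u y)" by auto
  from Suc.IH[OF u(3)] obtain w where w: "length w = k * n" "position w (shift u y) \<le> k * a" by blast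
  show ?case
    using u w by (intro exI[of _ "u @ w"]) (auto simp: words_def position_append algebra_simps)
qed simp

text \<open>
  Let \<open>q k\<close> be the probability of surviving \<open>k\<close> generations. To survive one more generation, some \<open>w\<close> in \<open>W\<close>
  has to be a child and its subtree has to survive. For each \<open>w\<close> this has probability
  \<open>early_prob w a * q k\<close>, and for two different words it has probability at most \<open>(q k)\<^sup>2\<close> because their subtrees are
  independent. So the Bonferroni bound yields the quadratic recursion whose linear coefficient is the mean number
  of children.
\<close>

lemma prob_lineage_bounded_below:
  assumes supercritical: "1 < mean_early J n a"
  shows "\<exists>e>0. \<forall>k. e \<le> prob {y \<in> space environment. lineage (words J n) a k y}"
proof -
  define W where "W = words J n"
  define q where "q k = prob {y \<in> space environment. lineage W a k y}" for k
  define D where "D k w = {y \<in> space environment. position w y \<le> a \<and> lineage W a k (shift w y)}" for k w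
  have fin: "finite W" and length_W: "\<And>w. w \<in> W \<Longrightarrow> length w = n"
    by (auto simp: W_def words_def[symmetric]) (simp add: words_def)
  note [measurable] = measurable_lineage[OF fin]
  have D_event [measurable]: "D k w \<in> events" for k w
    unfolding D_def by measurable
  have D_prob: "prob (D k w) = early_prob w a * q k" for k w
    unfolding D_def q_def by (rule prob_prefix_and_shift) measurable
  have D_UN: "{y \<in> space environment. lineage W a (Suc k) y} = (\<Union>w\<in>W. D k w)" for k
    by (auto simp: D_def)
  have q_nonneg: "0 \<le> q k" for k by (simp add: q_def)
  obtain w0 where w0: "w0 \<in> W" "0 < early_prob w0 a"
  proof -
    have "\<exists>w\<in>W. early_prob w a \<noteq> 0"
      using supercritical unfolding mean_early_def W_def[symmetric] by (metis not_one_less_zero sum.neutral)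
    then show ?thesis using that by (metis less_eq_real_def early_prob_nonneg)
  qed
  have "\<exists>e>0. \<forall>k. e \<le> q k"
  proof (rule supercritical_recursion_bounded_below)
    show "1 < mean_early J n a" by fact
    have "W \<noteq> {}" using w0 by auto
    then show "0 < (real (card W))\<^sup>2" using fin by (simp add: card_gt_0_iff)
    show "q (Suc k) \<le> q k" for k
      unfolding q_def using lineage_antimono by (intro finite_measure_mono) (auto simp del: lineage.simps)
    show "0 < q k" for k
    proof (induction k)
      case (Suc k)
      have "0 < prob (D k w0)" using Suc w0 by (simp add: D_prob)
      also have "\<dots> \<le> q (Suc k)"
        unfolding q_def D_UN using w0 fin by (intro finite_measure_mono) auto
      finally show ?case .
    qed (simp add: q_def prob_space)
    show "mean_early J n a * q k - (real (card W))\<^sup>2 * (q k)\<^sup>2 \<le> q (Suc k)" for k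
    proof -
      have "prob (D k v \<inter> D k w) \<le> (q k)\<^sup>2" if vw: "v \<in> W" "w \<in> W" "v \<noteq> w" for v w
      proof -
        have "prob (D k v \<inter> D k w) \<le>
            prob {y \<in> space environment. lineage W a k (shift v y) \<and> lineage W a k (shift w y)}"
          by (rule finite_measure_mono) (auto simp: D_def)
        also have "\<dots> = prob {y \<in> space environment. lineage W a k (shift v y)} *
                        prob {y \<in> space environment. lineage W a k (shift w y)}"
        proof (rule prob_Int_disjoint)
          show "range ((@) v) \<inter> range ((@) w) = {}"
            using vw length_W by auto
        qed measurable
        also have "\<dots> = (q k)\<^sup>2"
          by (simp add: prob_shift q_def power2_eq_square)
        finally show ?thesis .
      qed
      then have "(\<Sum>w\<in>W. prob (D k w)) - (real (card W))\<^sup>2 * (q k)\<^sup>2 \<le> prob (\<Union>w\<in>W. D k w)"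
        using fin by (intro bonferroni_pairs) auto
      then show ?thesis
        by (simp add: D_prob mean_early_def W_def[symmetric] sum_distrib_right q_def[of "Suc k"] D_UN del: lineage.simps)
    qed
  qed
  then show ?thesis by (simp add: q_def W_def)
qed

text \<open>
  The subtrees of the first \<open>m + 1\<close> children of the root are independent, and each fails to survive with
  probability at most \<open>1 - e\<close>. The powers of \<open>1 - e\<close> vanish in the limit.
\<close>

lemma AE_child_with_infinite_lineage:
  assumes "1 < mean_early J n a"
  shows "AE y in environment. \<exists>j. \<forall>k. lineage (words J n) a k (shift [j] y)"
proof -
  define G where "G y \<longleftrightarrow> (\<forall>k. lineage (words J n) a k y)" for y
  have [measurable]: "Measurable.pred environment G" unfolding G_def by measurable
  from prob_lineage_bounded_below[OF assms] obtain e where e: "0 < e"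
    "\<And>k. e \<le> prob {y \<in> space environment. lineage (words J n) a k y}" by blast
  have "(\<lambda>k. prob {y \<in> space environment. lineage (words J n) a k y})
      \<longlonglongrightarrow> prob (\<Inter>k. {y \<in> space environment. lineage (words J n) a k y})"
    using lineage_antimono by (intro finite_Lim_measure_decseq) (auto simp: decseq_Suc_iff simp del: lineage.simps)
  then have "e \<le> prob (\<Inter>k. {y \<in> space environment. lineage (words J n) a k y})"
    using e by (intro LIMSEQ_le_const) auto
  also have "(\<Inter>k. {y \<in> space environment. lineage (words J n) a k y}) = {y \<in> space environment. G y}"
    by (auto simp: G_def)
  finally have G: "e \<le> prob {y \<in> space environment. G y}" .
  let ?F = "\<lambda>j. {y \<in> space environment. \<not> G (shift [j] y)}"
  have F: "prob (?F j) \<le> 1 - e" for j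
  proof -
    have "prob (?F j) = prob {y \<in> space environment. \<not> G y}" by (rule prob_shift) measurable
    then show ?thesis using G by (simp add: prob_neg)
  qed
  have e1: "e \<le> 1" using G prob_le_1[of "{y \<in> space environment. G y}"] by linarith
  have bound: "prob {y \<in> space environment. \<forall>j. \<not> G (shift [j] y)} \<le> (1 - e) ^ Suc m" for m
  proof -
    have "prob {y \<in> space environment. \<forall>j. \<not> G (shift [j] y)} \<le> prob (\<Inter>j\<in>{..m}. ?F j)"
      by (rule finite_measure_mono) auto
    also have "\<dots> = (\<Prod>j\<in>{..m}. prob (?F j))"
    proof (rule indep_setsD[OF indep_coordinate_sigma[of "\<lambda>j. range ((@) [j])" UNIV]])
      show "\<forall>j\<in>{..m}. ?F j \<in> sets (coordinate_sigma (range ((@) [j])))"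
      proof
        fix j
        have "Measurable.pred (coordinate_sigma (range ((@) [j]))) (\<lambda>y. \<not> G (shift [j] y))"
          by measurable
        from predE[OF this] show "?F j \<in> sets (coordinate_sigma (range ((@) [j])))" by simp
      qed
    qed (auto simp: disjoint_family_on_def)
    also have "\<dots> \<le> (\<Prod>j\<in>{..m}. 1 - e)"
      using F by (intro prod_mono) auto
    finally show ?thesis by simp
  qed
  have "(\<lambda>m. (1 - e) ^ Suc m) \<longlonglongrightarrow> 0"
    using e(1) e1 by (intro LIMSEQ_Suc LIMSEQ_power_zero) auto
  then have "prob {y \<in> space environment. \<forall>j. \<not> G (shift [j] y)} \<le> 0"
    using bound by (intro LIMSEQ_le_const) auto
  then have "prob {y \<in> space environment. \<forall>j. \<not> G (shift [j] y)} = 0"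
    by (simp add: measure_le_0_iff)
  then have "AE y in environment. y \<notin> {y \<in> space environment. \<forall>j. \<not> G (shift [j] y)}"
    by (subst (asm) prob_eq_0) auto
  then show ?thesis
    by (rule AE_mp) (auto simp: G_def)
qed

section \<open>The speed of first passage\<close>

definition first_passage :: "nat \<Rightarrow> (nat list \<Rightarrow> 'b) \<Rightarrow> real" where
  "first_passage n y = (INF w\<in>{w. length w = n}. position w y)"

lemma bdd_below_position: "bdd_below ((\<lambda>w. position w y) ` A)"
  by (rule bdd_belowI[of _ 0]) auto

lemma first_passage_le: "length w = n \<Longrightarrow> first_passage n y \<le> position w y"
  unfolding first_passage_def by (rule cINF_lower[OF bdd_below_position]) simp

lemma first_passage_greatest:
  assumes "\<And>w. length w = n \<Longrightarrow> c \<le> position w y"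
  shows "c \<le> first_passage n y"
  unfolding first_passage_def
proof (rule cINF_greatest)
  have "replicate n 0 \<in> {w :: nat list. length w = n}" by simp
  then show "{w :: nat list. length w = n} \<noteq> {}" by blast
qed (use assms in auto)

lemma first_passage_le_longer:
  assumes "n \<le> length w"
  shows "first_passage n y \<le> position w y"
proof -
  have "first_passage n y \<le> position (take n w) y"
    using assms by (intro first_passage_le) simp
  also have "\<dots> \<le> position (take n w @ drop n w) y"
    unfolding position_append by simp
  finally show ?thesis by simp
qed

text \<open>
  A surviving child \<open>j\<close> of the root provides, for each \<open>k\<close>, a word of length \<open>Suc (k * n)\<close> at a position of
  at most \<open>k * a\<close> beyond that of \<open>j\<close>. The generations in between are covered by monotonicity of
  \<open>first_passage\<close>, and the random position of \<open>j\<close> is negligible in the limit.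
\<close>

lemma AE_first_passage_upper:
  fixes e :: real
  assumes "1 < mean_early J n a" "0 < n" "a / n < e"
  shows "AE y in environment. eventually (\<lambda>N. first_passage N y < e * N) sequentially"
  using AE_child_with_infinite_lineage[OF assms(1)]
proof (rule AE_mp, intro AE_I2 impI)
  fix y assume "\<exists>j. \<forall>k. lineage (words J n) a k (shift [j] y)"
  then obtain j where j: "\<And>k. lineage (words J n) a k (shift [j] y)" by blast
  have a: "0 \<le> a"
  proof (rule ccontr)
    assume "\<not> 0 \<le> a"
    have "\<not> position w y \<le> a" for w y using position_nonneg[of w y] \<open>\<not> 0 \<le> a\<close> by linarith
    then have "mean_early J n a = 0"
      unfolding mean_early_def early_prob_def by simp
    then show False using assms(1) by simp
  qed
  define c where "c = position [j] y"
  have upper: "first_passage N y \<le> c + a + N * (a / n)" for N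
  proof -
    define k where "k = N div n + 1"
    obtain w where w: "length w = k * n" "position w (shift [j] y) \<le> k * a"
      using lineage_word[OF j] by blast
    have "N \<le> k * n"
      using assms(2) by (simp add: k_def) (metis add.commute dividend_less_div_times less_imp_le)
    then have "first_passage N y \<le> position ([j] @ w) y"
      using w by (intro first_passage_le_longer) simp
    also have "\<dots> \<le> c + k * a" unfolding position_append using w by (simp add: c_def)
    also have "k * a \<le> (N / n + 1) * a"
      using a of_nat_div_le_of_nat[of N n, where 'a = real] by (intro mult_right_mono) (auto simp: k_def)
    finally show ?thesis by (simp add: algebra_simps)
  qed
  obtain N0 :: nat where N0: "(c + a) / (e - a / n) < N0" using reals_Archimedean2 by blast
  show "eventually (\<lambda>N. first_passage N y < e * N) sequentially"
    unfolding eventually_sequentially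
  proof (intro exI allI impI)
    fix N assume "N0 \<le> N"
    then have "(c + a) / (e - a / n) < N" using N0 by linarith
    then have "c + a < N * (e - a / n)" using assms(3) by (simp add: field_simps)
    then show "first_passage N y < e * N" using upper[of N] by (simp add: algebra_simps)
  qed
qed

text \<open>The union bound over infinitely many words, as a limit of the bounds for finite alphabets.\<close>

lemma prob_Ex_word_le:
  assumes "\<And>J. mean_early J n a \<le> c"
  shows "prob {y \<in> space environment. \<exists>w. length w = n \<and> position w y \<le> a} \<le> c"
proof -
  let ?A = "\<lambda>J. {y \<in> space environment. \<exists>w\<in>words J n. position w y \<le> a}"
  have [measurable]: "?A J \<in> events" for J
    by (intro sets.sets_Collect_finite_Ex) auto
  have "(\<lambda>J. prob (?A J)) \<longlonglongrightarrow> prob (\<Union>J. ?A J)"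
    using words_mono by (intro finite_Lim_measure_incseq) (auto simp: incseq_def, blast)
  moreover have "prob (?A J) \<le> c" for J
  proof -
    have "prob (?A J) = prob (\<Union>w\<in>words J n. {y \<in> space environment. position w y \<le> a})"
      by (rule arg_cong[where f = prob]) auto
    also have "\<dots> \<le> (\<Sum>w\<in>words J n. prob {y \<in> space environment. position w y \<le> a})"
      by (intro finite_measure_subadditive_finite) auto
    also have "\<dots> \<le> c" using assms[of J] by (simp add: mean_early_def early_prob_def)
    finally show ?thesis .
  qed
  ultimately have "prob (\<Union>J. ?A J) \<le> c" by (intro LIMSEQ_le_const2) auto
  also have "(\<Union>J. ?A J) = {y \<in> space environment. \<exists>w. length w = n \<and> position w y \<le> a}"
  proof -
    have "\<exists>J. w \<in> words J (length w)" for w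
    proof
      show "w \<in> words (Suc (Max (set w \<union> {0}))) (length w)"
        by (auto simp: words_def less_Suc_eq_le)
    qed
    then show ?thesis by (fastforce simp: words_def)
  qed
  finally show ?thesis .
qed

text \<open>
  With \<open>k = \<lfloor>\<theta> * n\<rfloor>\<close> additional generations at speed \<open>c\<close>, words of speed \<open>a\<close> still have speed at most \<open>b\<close>
  altogether. The additional generations multiply the mean number of such words by at least \<open>2 ^ k\<close>, yet the result
  is at most \<open>1\<close>. So the mean is exponentially small and Borel--Cantelli applies.
\<close>

lemma AE_first_passage_lower:
  fixes a b :: real
  assumes critical: "\<And>n J. 0 < n \<Longrightarrow> mean_early J n (b * n) \<le> 1"
    and many: "\<exists>J c. 0 < c \<and> 2 \<le> mean_early J 1 c" and a: "a < b" and b: "0 \<le> b"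
  shows "AE y in environment. eventually (\<lambda>n. a * n \<le> first_passage n y) sequentially"
proof -
  obtain J0 c where c: "0 < c" "2 \<le> mean_early J0 1 c" using many by blast
  define \<theta> where "\<theta> = (b - a) / c"
  have \<theta>: "0 < \<theta>" using a c by (simp add: \<theta>_def)
  have mean_early_le: "mean_early J n (a * n) \<le> 2 * (2 powr - \<theta>) ^ n" if n: "0 < n" for J n
  proof -
    define K where "K = max J J0"
    define k where "k = nat \<lfloor>\<theta> * n\<rfloor>"
    \<comment> \<open>The rounding of \<open>k\<close> costs the factor \<open>2\<close> in the claim.\<close>
    have k: "k \<le> \<theta> * n" "\<theta> * n - 1 \<le> k"
      using \<theta> by (auto simp: k_def)
    have "2 \<le> mean_early K 1 c" using c(2) mean_early_mono_index[of J0 K 1 c] by (simp add: K_def)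
    then have "2 ^ k \<le> mean_early K 1 c ^ k" by (intro power_mono) auto
    also have "\<dots> \<le> mean_early K k (k * c)" using c by (intro mean_early_power) simp
    finally have "mean_early K n (a * n) * 2 ^ k \<le> mean_early K n (a * n) * mean_early K k (k * c)"
      by (simp add: mult_left_mono)
    also have "\<dots> \<le> mean_early K (n + k) (a * n + k * c)" by (rule mean_early_supermultiplicative)
    also have "\<dots> \<le> mean_early K (n + k) (b * (n + k))"
    proof (rule mean_early_mono)
      have "k * c \<le> \<theta> * n * c" using k c by (simp add: mult_right_mono)
      also have "\<dots> = (b - a) * n" using c by (simp add: \<theta>_def)
      finally have "k * c \<le> (b - a) * n" .
      moreover have "0 \<le> b * k" using b by simp
      ultimately show "a * n + k * c \<le> b * real (n + k)"
        by (simp add: algebra_simps)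
    qed
    also have "\<dots> \<le> 1" using n by (intro critical) simp
    finally have "mean_early K n (a * n) \<le> 1 / 2 ^ k" by (simp add: field_simps)
    also have "\<dots> = 2 powr - real k" by (simp add: powr_minus powr_realpow divide_inverse)
    also have "\<dots> \<le> 2 powr (1 - \<theta> * n)" using k by (intro powr_mono) auto
    also have "\<dots> = 2 * (2 powr - \<theta>) ^ n"
      by (simp add: powr_power power_inverse mult.commute powr_diff powr_minus divide_inverse)
    finally have "mean_early K n (a * n) \<le> 2 * (2 powr - \<theta>) ^ n" .
    moreover have "mean_early J n (a * n) \<le> mean_early K n (a * n)" by (rule mean_early_mono_index) (simp add: K_def)
    ultimately show ?thesis by linarith
  qed
  let ?A = "\<lambda>n. {y \<in> space environment. \<exists>w. length w = n \<and> position w y \<le> a * n}"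
  have "summable (\<lambda>n. prob (?A n))"
  proof (rule summable_comparison_test)
    have "norm (prob (?A n)) \<le> 2 * (2 powr - \<theta>) ^ n" if "1 \<le> n" for n
      using that mean_early_le by (simp add: prob_Ex_word_le)
    then show "\<exists>N. \<forall>n\<ge>N. norm (prob (?A n)) \<le> 2 * (2 powr - \<theta>) ^ n" by blast
    have "norm (2 powr - \<theta>) < 1" using \<theta> powr_less_mono[of "-\<theta>" 0 2] by simp
    then show "summable (\<lambda>n. 2 * (2 powr - \<theta>) ^ n)"
      by (intro summable_mult summable_geometric)
  qed
  then have "AE y in environment. eventually (\<lambda>n. y \<in> space environment - ?A n) sequentially"
    by (intro borel_cantelli_AE1) (auto simp: emeasure_eq_measure)
  then show ?thesis
  proof (rule AE_mp, intro AE_I2 impI)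
    fix y assume "y \<in> space environment" and "eventually (\<lambda>n. y \<in> space environment - ?A n) sequentially"
    then show "eventually (\<lambda>n. a * n \<le> first_passage n y) sequentially"
    proof (elim eventually_mono)
      fix n assume "y \<in> space environment - ?A n"
      then have "a * n \<le> position w y" if "length w = n" for w
        using that by (auto simp: not_le intro: less_imp_le)
      then show "a * n \<le> first_passage n y" by (rule first_passage_greatest)
    qed
  qed
qed

text \<open>
  The speed \<open>\<alpha>\<close> is the infimum of all \<open>a / n\<close> for which the words of length \<open>n\<close> up to position \<open>a\<close> are
  supercritical for some finite alphabet. The hypothesis on \<open>\<delta>\<close> says that no speed up to \<open>\<delta>\<close> is
  supercritical, which makes \<open>\<alpha>\<close> positive.
\<close>

theorem first_passage_speed:
  fixes \<delta> :: real
  assumes positive: "0 < \<delta>" "\<And>n J. 0 < n \<Longrightarrow> mean_early J n (\<delta> * n) \<le> 1"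
    and many: "\<exists>J c. 0 < c \<and> 2 \<le> mean_early J 1 c"
  shows "\<exists>\<alpha>>0. AE y in environment. (\<lambda>n. first_passage n y / n) \<longlonglongrightarrow> \<alpha>"
proof -
  define R where "R = {a / real n |a n. 0 < n \<and> (\<exists>J. 1 < mean_early J n a)}"
  define \<alpha> where "\<alpha> = Inf R"
  have "R \<noteq> {}"
  proof -
    obtain J c where "2 \<le> mean_early J 1 c" using many by blast
    then have "c / real 1 \<in> R" unfolding R_def by (intro CollectI exI[of _ c] exI[of _ "1 :: nat"] conjI exI[of _ J]) auto
    then show ?thesis by blast
  qed
  have lower: "\<delta> \<le> r" if "r \<in> R" for r
  proof -
    from that obtain a n J where r: "r = a / real n" "0 < n" "1 < mean_early J n a" unfolding R_def by blast
    have "\<not> a \<le> \<delta> * n" using mean_early_mono[of a "\<delta> * n" J n] positive(2)[OF r(2), of J] r(3) by linarith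
    then have "\<delta> * n < a" by simp
    then show ?thesis using r(1,2) by (simp add: pos_le_divide_eq)
  qed
  then have bdd: "bdd_below R" by (rule bdd_belowI)
  have \<alpha>: "\<delta> \<le> \<alpha>" unfolding \<alpha>_def using \<open>R \<noteq> {}\<close> lower by (rule cInf_greatest)
  have critical: "mean_early J n (b * n) \<le> 1" if "b < \<alpha>" "0 < n" for b J n
  proof (rule ccontr)
    assume "\<not> mean_early J n (b * n) \<le> 1"
    then have "b * n / real n \<in> R" unfolding R_def using that(2) by (blast intro: not_le[THEN iffD1])
    then have "\<alpha> \<le> b" unfolding \<alpha>_def using bdd that(2) by (simp add: cInf_lower)
    then show False using that(1) by simp
  qed
  have "AE y in environment. eventually (\<lambda>n. first_passage n y < (\<alpha> + 1 / real (Suc i)) * n) sequentially" for i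
  proof -
    have "\<alpha> < \<alpha> + 1 / real (Suc i)" by simp
    then obtain r where "r \<in> R" "r < \<alpha> + 1 / real (Suc i)"
      unfolding \<alpha>_def using \<open>R \<noteq> {}\<close> bdd cInf_less_iff by blast
    then show ?thesis unfolding R_def by (auto intro: AE_first_passage_upper)
  qed
  moreover have "AE y in environment. eventually (\<lambda>n. (\<alpha> - 1 / real (Suc i)) * n \<le> first_passage n y) sequentially" for i
  proof -
    \<comment> \<open>The bound \<open>b\<close> has to lie strictly between the speed to be shown and \<open>\<alpha>\<close>, and to be nonnegative.\<close>
    define b where "b = max 0 (\<alpha> - 1 / real (i + 2))"
    have b: "b < \<alpha>" "0 \<le> b" using \<alpha> positive(1) by (auto simp: b_def)
    have "\<alpha> - 1 / real (Suc i) < \<alpha> - 1 / real (i + 2)" by (simp add: frac_less2)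
    also have "\<dots> \<le> b" by (simp add: b_def)
    finally show ?thesis using critical[OF b(1)] many b(2) by (intro AE_first_passage_lower) auto
  qed
  ultimately have "AE y in environment. \<forall>i.
      eventually (\<lambda>n. first_passage n y < (\<alpha> + 1 / real (Suc i)) * n) sequentially \<and>
      eventually (\<lambda>n. (\<alpha> - 1 / real (Suc i)) * n \<le> first_passage n y) sequentially"
    by (simp add: AE_all_countable)
  then have "AE y in environment. (\<lambda>n. first_passage n y / n) \<longlonglongrightarrow> \<alpha>"
  proof (rule AE_mp, intro AE_I2 impI)
    fix y
    assume *: "\<forall>i.
      eventually (\<lambda>n. first_passage n y < (\<alpha> + 1 / real (Suc i)) * n) sequentially \<and>
      eventually (\<lambda>n. (\<alpha> - 1 / real (Suc i)) * n \<le> first_passage n y) sequentially"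
    show "(\<lambda>n. first_passage n y / n) \<longlonglongrightarrow> \<alpha>"
    proof (rule tendstoI)
      fix e :: real assume "0 < e"
      then obtain i where i: "1 / real (Suc i) < e" using nat_approx_posE by blast
      from *[rule_format, of i] have
        "eventually (\<lambda>n. first_passage n y < (\<alpha> + 1 / real (Suc i)) * n) sequentially"
        "eventually (\<lambda>n. (\<alpha> - 1 / real (Suc i)) * n \<le> first_passage n y) sequentially" by auto
      then show "eventually (\<lambda>n. dist (first_passage n y / n) \<alpha> < e) sequentially"
        using eventually_gt_at_top[of 0]
      proof eventually_elim
        case (elim n)
        then have "first_passage n y / n < \<alpha> + 1 / real (Suc i)" "\<alpha> - 1 / real (Suc i) \<le> first_passage n y / n"
          by (simp_all only: pos_divide_less_eq pos_le_divide_eq of_nat_0_less_iff)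
        then show ?case using i by (simp add: dist_real_def abs_less_iff)
      qed
    qed
  qed
  then show ?thesis using \<alpha> positive(1) by (intro exI[of _ \<alpha>]) auto
qed

section \<open>Exponential moments\<close>

lemma indep_var_disjoint:
  fixes f g :: "(nat list \<Rightarrow> 'b) \<Rightarrow> real"
  assumes "K \<inter> K' = {}" and f: "f \<in> borel_measurable (coordinate_sigma K)"
    and g: "g \<in> borel_measurable (coordinate_sigma K')"
  shows "indep_var borel f borel g"
  unfolding indep_var_def indep_vars_def2
proof (intro conjI ballI)
  show "random_variable (case b of True \<Rightarrow> borel | False \<Rightarrow> borel) (case b of True \<Rightarrow> f | False \<Rightarrow> g)" for b
    using f g by (auto split: bool.split intro: measurable_coordinate_sigma_mono)
  let ?K = "\<lambda>b. if b then K else K'"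
  have "indep_sets (\<lambda>b. sets (coordinate_sigma (?K b))) UNIV"
    using assms(1) by (intro indep_coordinate_sigma) (auto simp: disjoint_family_on_def)
  then show "indep_sets (\<lambda>b. {(case b of True \<Rightarrow> f | False \<Rightarrow> g) -` A \<inter> space environment |A.
      A \<in> sets (case b of True \<Rightarrow> borel | False \<Rightarrow> borel)}) UNIV"
  proof (rule indep_sets_mono_sets)
    show "{(case b of True \<Rightarrow> f | False \<Rightarrow> g) -` A \<inter> space environment |A.
      A \<in> sets (case b of True \<Rightarrow> borel | False \<Rightarrow> borel)} \<subseteq> sets (coordinate_sigma (?K b))" for b
      using measurable_sets[OF f] measurable_sets[OF g] by (auto split: bool.split)
  qed
qed

definition laplace :: "real \<Rightarrow> nat list \<Rightarrow> real" where
  "laplace s w = expectation (\<lambda>y. exp (- s * position w y))"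

lemma integrable_exp_position: "0 \<le> s \<Longrightarrow> integrable environment (\<lambda>y. exp (- s * position w y))"
  by (rule integrable_const_bound[of _ 1]) auto

text \<open>The exponential moment factorizes by the same independence as in \<open>prob_prefix_and_shift\<close>.\<close>

lemma laplace_append:
  assumes "0 \<le> s"
  shows "laplace s (u @ v) = laplace s u * laplace s v"
proof -
  have "laplace s (u @ v) = expectation (\<lambda>y. exp (- s * position u y) * exp (- s * position v (shift u y)))"
    unfolding laplace_def by (simp add: position_append algebra_simps flip: exp_add)
  also have "\<dots> = expectation (\<lambda>y. exp (- s * position u y)) * expectation (\<lambda>y. exp (- s * position v (shift u y)))"
  proof (rule indep_var_lebesgue_integral)
    have [measurable]: "position u \<in> borel_measurable (coordinate_sigma {w. length w < length u})"
      by (rule position_measurable_coordinate_sigma) simp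
    show "indep_var borel (\<lambda>y. exp (- s * position u y)) borel (\<lambda>y. exp (- s * position v (shift u y)))"
      by (rule indep_var_disjoint[of "{w. length w < length u}" "range ((@) u)"]) (auto, measurable)
    show "integrable environment (\<lambda>y. exp (- s * position v (shift u y)))"
      using assms by (intro integrable_const_bound[of _ 1]) auto
  qed (rule integrable_exp_position[OF assms])
  also have "expectation (\<lambda>y. exp (- s * position v (shift u y))) = laplace s v"
  proof -
    have "laplace s v = integral\<^sup>L (distr environment environment (shift u)) (\<lambda>y. exp (- s * position v y))"
      by (simp add: distr_shift laplace_def)
    also have "\<dots> = expectation (\<lambda>y. exp (- s * position v (shift u y)))"
      by (rule integral_distr) measurable
    finally show ?thesis ..
  qed
  finally show ?thesis by (simp add: laplace_def)
qed

lemma laplace_nonneg: "0 \<le> laplace s w"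
  unfolding laplace_def by (rule Bochner_Integration.integral_nonneg) simp

lemma sum_laplace_words:
  assumes "0 \<le> s"
  shows "(\<Sum>w\<in>words J n. laplace s w) = (\<Sum>j<J. laplace s [j]) ^ n"
proof (induction n)
  case 0
  have "words J 0 = {[]}" by (auto simp: words_def)
  then show ?case by (simp add: laplace_def prob_space)
next
  case (Suc n)
  have "(\<Sum>w\<in>words J (n + Suc 0). laplace s w) =
      (\<Sum>u\<in>words J n. laplace s u) * (\<Sum>j<J. laplace s [j])"
    unfolding sum_words_append sum_words_1 laplace_append[OF assms] sum_product ..
  then show ?case by (simp add: Suc.IH mult.commute)
qed

text \<open>Markov's inequality for each word, and multiplicativity of the Laplace transform along words.\<close>

lemma mean_early_le_laplace:
  assumes "0 \<le> s"
  shows "mean_early J n a \<le> exp (s * a) * (\<Sum>j<J. laplace s [j]) ^ n"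
proof -
  have "early_prob w a \<le> exp (s * a) * laplace s w" for w
  proof -
    have "early_prob w a = expectation (indicator {y \<in> space environment. position w y \<le> a})"
      by (simp add: early_prob_def)
    also have "\<dots> \<le> expectation (\<lambda>y. exp (s * a) * exp (- s * position w y))"
    proof (rule integral_mono)
      show "integrable environment (\<lambda>y. exp (s * a) * exp (- s * position w y))"
        using integrable_exp_position[OF assms] by simp
      show "indicator {y \<in> space environment. position w y \<le> a} y \<le> exp (s * a) * exp (- s * position w y)" for y
        using assms by (auto simp: indicator_def mult_left_mono simp flip: exp_add)
      show "integrable environment (indicator {y \<in> space environment. position w y \<le> a} :: _ \<Rightarrow> real)"
        by (intro integrable_real_indicator) (auto simp: emeasure_eq_measure)
    qed
    finally show ?thesis by (simp add: laplace_def)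
  qed
  then have "mean_early J n a \<le> (\<Sum>w\<in>words J n. exp (s * a) * laplace s w)"
    unfolding mean_early_def by (intro sum_mono)
  then show ?thesis by (simp add: sum_laplace_words[OF assms] flip: sum_distrib_left)
qed

text \<open>
  Rounding the position down to a multiple of \<open>h\<close> expresses the exponential moment by distribution
  functions; positions beyond \<open>K * h\<close> contribute the last summand.
\<close>

lemma laplace_le_step_function:
  fixes s h :: real
  assumes s: "0 \<le> s" and h: "0 < h"
  shows "laplace s w \<le> (\<Sum>k<K. exp (- s * (k * h)) * early_prob w (Suc k * h)) + exp (- s * (K * h))"
proof -
  let ?A = "\<lambda>k. {y \<in> space environment. position w y \<le> Suc k * h}"
  have "laplace s w \<le> expectation (\<lambda>y.
      (\<Sum>k<K. exp (- s * (k * h)) * indicator (?A k) y) + exp (- s * (K * h)))"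
    unfolding laplace_def
  proof (rule integral_mono)
    show "integrable environment (\<lambda>y. (\<Sum>k<K. exp (- s * (k * h)) * indicator (?A k) y) + exp (- s * (K * h)))"
      by (intro Bochner_Integration.integrable_add Bochner_Integration.integrable_sum
          integrable_mult_right integrable_real_indicator) (auto simp: emeasure_eq_measure)
    fix y assume y: "y \<in> space environment"
    define k where "k = nat \<lfloor>position w y / h\<rfloor>"
    have "real k \<le> position w y / h" "position w y / h \<le> Suc k" using h real_of_int_floor_add_one_ge[of "position w y / h"] by (simp_all add: k_def add.commute)
    then have k: "k * h \<le> position w y" "position w y \<le> Suc k * h" using h by (simp_all add: field_simps)
    show "exp (- s * position w y) \<le> (\<Sum>k<K. exp (- s * (k * h)) * indicator (?A k) y) + exp (- s * (K * h))"
    proof (cases "k < K")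
      case True
      have "exp (- s * position w y) \<le> exp (- s * (k * h)) * indicator (?A k) y"
        using k y s by (simp add: mult_left_mono)
      also have "\<dots> \<le> (\<Sum>k<K. exp (- s * (k * h)) * indicator (?A k) y)"
        using True by (intro member_le_sum) auto
      finally show ?thesis by (simp add: add_increasing2)
    next
      case False
      then have "K * h \<le> k * h" using h by simp
      then have "exp (- s * position w y) \<le> exp (- s * (K * h))"
        using k s by (simp add: mult_left_mono)
      then show ?thesis by (simp add: add_increasing sum_nonneg)
    qed
  qed (rule integrable_exp_position[OF s])
  also have "\<dots> = (\<Sum>k<K. exp (- s * (k * h)) * early_prob w (Suc k * h)) + exp (- s * (K * h))"
  proof -
    have "integrable environment (indicator (?A k) :: _ \<Rightarrow> real)" for k
      by (intro integrable_real_indicator) (auto simp: emeasure_eq_measure)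
    then show ?thesis
      by (simp add: Bochner_Integration.integral_add Bochner_Integration.integral_sum
          Bochner_Integration.integrable_sum early_prob_def prob_space del: sum_mult_indicator)
  qed
  finally show ?thesis .
qed

end

section \<open>Speed in terms of the intensity of the displacements\<close>

text \<open>\<open>\<Lambda> c\<close> is the expected number of children of a word that are displaced from it by at most \<open>c\<close>.\<close>

locale branching_random_walk_intensity = branching_random_walk +
  fixes \<Lambda> :: "real \<Rightarrow> real"
  assumes intensity: "0 \<le> c \<Longrightarrow> (\<lambda>j. early_prob [j] c) sums \<Lambda> c"
    and intensity_at_0: "0 < e \<Longrightarrow> \<exists>h>0. \<Lambda> h \<le> e"
    and intensity_unbounded: "\<exists>c>0. r \<le> \<Lambda> c"
begin

lemma mean_early_1: "mean_early J 1 c = (\<Sum>j<J. early_prob [j] c)"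
  by (simp add: mean_early_def sum_words_1)

lemma mean_early_1_le_intensity: "0 \<le> c \<Longrightarrow> mean_early J 1 c \<le> \<Lambda> c"
  unfolding mean_early_1 using intensity[of c] sum_le_suminf[of "\<lambda>j. early_prob [j] c" "{..<J}"] by (simp add: sums_iff)

lemma mean_early_1_exceeds:
  assumes "0 \<le> c" "r < \<Lambda> c"
  shows "\<exists>J. r < mean_early J 1 c"
proof -
  have "(\<lambda>J. mean_early J 1 c) \<longlonglongrightarrow> \<Lambda> c"
    unfolding mean_early_1 using intensity[OF assms(1)] by (simp add: sums_def)
  from order_tendstoD(1)[OF this assms(2)] show ?thesis
    by (auto simp: eventually_sequentially)
qed

lemma intensity_nonneg: "0 \<le> c \<Longrightarrow> 0 \<le> \<Lambda> c"
  by (rule order_trans[OF mean_early_nonneg mean_early_1_le_intensity])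

lemma intensity_mono: "0 \<le> c \<Longrightarrow> c \<le> d \<Longrightarrow> \<Lambda> c \<le> \<Lambda> d"
  by (rule sums_le[OF early_prob_mono intensity intensity]) simp_all

lemma two_children_within_bounded_distance: "\<exists>J c. 0 < c \<and> 2 \<le> mean_early J 1 c"
proof -
  obtain c where "0 < c" "3 \<le> \<Lambda> c" using intensity_unbounded by blast
  moreover from this obtain J where "2 < mean_early J 1 c" using mean_early_1_exceeds[of c 2] by auto
  ultimately show ?thesis by (intro exI[of _ J] exI[of _ c]) simp
qed

lemma mean_early_eq_0_if_no_short_edges:
  assumes t: "0 < t" "\<Lambda> t = 0" and n: "0 < n"
  shows "mean_early J n (t * n) = 0"
proof -
  have p0: "early_prob [j] t = 0" for j
  proof -
    have "early_prob [j] t \<le> mean_early (Suc j) 1 t" unfolding mean_early_1 by (simp add: sum_nonneg)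
    also have "\<dots> \<le> 0" using mean_early_1_le_intensity[of t "Suc j"] t by simp
    finally show ?thesis by (simp add: antisym)
  qed
  have "early_prob w (t * n) = 0" if w: "length w = n" for w
  proof -
    let ?short = "\<lambda>k. {y \<in> space environment. position [w ! k] (shift (take k w) y) \<le> t}"
    have "early_prob w (t * n) \<le> prob (\<Union>k<n. ?short k)"
      unfolding early_prob_def
    proof (rule finite_measure_mono)
      show "{y \<in> space environment. position w y \<le> t * n} \<subseteq> (\<Union>k<n. ?short k)"
      proof (rule subsetI, rule ccontr)
        fix y assume y: "y \<in> {y \<in> space environment. position w y \<le> t * n}" "y \<notin> (\<Union>k<n. ?short k)"
        then have "\<And>k. k < n \<Longrightarrow> t < X (w ! k) (y (take k w))"
          by (auto simp: position_def shift_def not_le)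
        then have "(\<Sum>k<n. t) < position w y"
          unfolding position_def w using n by (intro sum_strict_mono) auto
        then show False using y by (simp add: mult.commute)
      qed
    qed auto
    also have "\<dots> \<le> (\<Sum>k<n. prob (?short k))"
      by (intro finite_measure_subadditive_finite) auto
    also have "\<dots> = (\<Sum>k<n. early_prob [w ! k] t)"
      unfolding early_prob_def by (intro sum.cong refl prob_shift) measurable
    finally show ?thesis by (simp add: p0 antisym)
  qed
  then show ?thesis by (simp add: mean_early_def words_def)
qed

text \<open>
  On a grid of mesh \<open>h\<close> the Laplace transform of the intensity is at most
  \<open>\<Sum>k. exp (- s * k * h) * \<Lambda> ((k + 1) * h)\<close>. The first term is small when \<open>h\<close> is, since \<open>\<Lambda>\<close> vanishes at \<open>0\<close> in
  the limit. The others are dominated by a geometric series whose ratio \<open>r\<close> is as small as desired when \<open>s\<close> is large.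
\<close>

lemma sum_laplace_le:
  assumes C: "0 < C" "\<And>x. 0 \<le> x \<Longrightarrow> \<Lambda> x \<le> C powr x" and \<epsilon>: "0 < \<epsilon>"
  shows "\<exists>s>0. \<forall>J. (\<Sum>j<J. laplace s [j]) \<le> \<epsilon>"
proof -
  define D where "D = max C 1"
  have D: "1 \<le> D" by (simp add: D_def)
  have \<Lambda>_le: "\<Lambda> x \<le> D powr x" if "0 \<le> x" for x
    using C(2)[OF that] powr_mono2[of x C D] C(1) that by (auto simp: D_def)
  obtain h where h: "0 < h" "\<Lambda> h \<le> \<epsilon> / 3" using intensity_at_0[of "\<epsilon> / 3"] \<epsilon> by auto
  define r where "r = min (1/2) (\<epsilon> / (6 * D powr h))"
  have r: "0 < r" "r \<le> 1 / 2" "D powr h * r \<le> \<epsilon> / 6"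
  proof -
    show "0 < r" "r \<le> 1 / 2" using \<epsilon> D by (auto simp: r_def)
    have "D powr h * r \<le> D powr h * (\<epsilon> / (6 * D powr h))"
      unfolding r_def by (intro mult_left_mono) auto
    then show "D powr h * r \<le> \<epsilon> / 6" using D by simp
  qed
  \<comment> \<open>The solution of \<open>exp (- s * h) * D powr h = r\<close>.\<close>
  define s where "s = ln D - ln r / h"
  have "ln r < 0" using r by simp
  then have "ln r / h < 0" using h(1) by (rule divide_neg_pos)
  moreover have "0 \<le> ln D" using D by simp
  ultimately have s: "0 < s" unfolding s_def by linarith
  have exp_s: "exp (- s * h) * D powr h = r"
  proof -
    have "- s * h + h * ln D = ln r" using h(1) by (simp add: s_def field_simps)
    then show ?thesis using D r(1) by (simp add: powr_def flip: exp_add)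
  qed
  have term_le: "exp (- s * (k * h)) * \<Lambda> (Suc k * h) \<le> \<epsilon> / 3 * (1 / 2) ^ k" for k :: nat
  proof (cases k)
    case 0
    then show ?thesis using h by simp
  next
    case (Suc i)
    have "exp (- s * (k * h)) * \<Lambda> (Suc k * h) \<le> exp (- s * (k * h)) * D powr (Suc k * h)"
      using h(1) by (intro mult_left_mono \<Lambda>_le) auto
    also have "\<dots> = D powr h * (exp (- s * h) * D powr h) ^ k"
      using D by (simp add: power_mult_distrib powr_power algebra_simps flip: exp_of_nat_mult powr_add)
    also have "\<dots> = D powr h * r * r ^ i" unfolding exp_s by (simp add: Suc)
    also have "\<dots> \<le> \<epsilon> / 6 * (1 / 2) ^ i"
      using r \<epsilon> by (intro mult_mono power_mono) auto
    finally show ?thesis by (simp add: Suc)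
  qed
  have "(\<Sum>j<J. laplace s [j]) \<le> \<epsilon>" for J
  proof -
    have bound: "(\<Sum>j<J. laplace s [j]) \<le> 2 * \<epsilon> / 3 + J * exp (- s * h) ^ K" for K :: nat
    proof -
      have "(\<Sum>j<J. laplace s [j]) \<le>
          (\<Sum>j<J. (\<Sum>k<K. exp (- s * (k * h)) * early_prob [j] (Suc k * h)) + exp (- s * (K * h)))"
        using s h(1) by (intro sum_mono laplace_le_step_function) auto
      also have "\<dots> = (\<Sum>k<K. exp (- s * (k * h)) * mean_early J 1 (Suc k * h)) + J * exp (- s * (K * h))"
        by (simp only: sum.distrib sum.swap[of _ "{..<J}"] mean_early_1 sum_distrib_left) simp
      also have "(\<Sum>k<K. exp (- s * (k * h)) * mean_early J 1 (Suc k * h)) \<le>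
          (\<Sum>k<K. exp (- s * (k * h)) * \<Lambda> (Suc k * h))"
        using h(1) by (intro sum_mono mult_left_mono mean_early_1_le_intensity) auto
      also have "\<dots> \<le> (\<Sum>k<K. \<epsilon> / 3 * (1 / 2) ^ k)" by (intro sum_mono term_le)
      also have "\<dots> = \<epsilon> / 3 * (2 - 2 * (1 / 2) ^ K)"
        using geometric_sum[of "1 / 2 :: real" K] by (simp only: sum_distrib_left[symmetric]) simp
      also have "\<dots> \<le> 2 * \<epsilon> / 3" using \<epsilon> by (simp add: field_simps)
      finally show ?thesis by (simp add: algebra_simps flip: exp_of_nat_mult)
    qed
    have "norm (exp (- s * h)) < 1" using s h(1) by simp
    from tendsto_add[OF tendsto_const tendsto_mult[OF tendsto_const LIMSEQ_power_zero[OF this]]]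
    have "(\<lambda>K. 2 * \<epsilon> / 3 + J * exp (- s * h) ^ K) \<longlonglongrightarrow> 2 * \<epsilon> / 3 + real J * 0" .
    from LIMSEQ_le_const[OF this] bound have "(\<Sum>j<J. laplace s [j]) \<le> 2 * \<epsilon> / 3 + real J * 0" by blast
    then show ?thesis using \<epsilon> by simp
  qed
  then show ?thesis using s by blast
qed

lemma mean_early_exponentially_small:
  assumes "(\<exists>t>0. \<Lambda> t = 0) \<or> (\<exists>C>0. \<forall>x\<ge>0. \<Lambda> x \<le> C powr x)"
  shows "\<exists>\<delta>>0. \<forall>n J. 0 < n \<longrightarrow> mean_early J n (\<delta> * n) \<le> exp (- K * n)"
  using assms
proof (elim disjE exE conjE)
  fix t assume "0 < t" "\<Lambda> t = 0"
  then show ?thesis using mean_early_eq_0_if_no_short_edges[of t] by (intro exI[of _ t]) simp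
next
  fix C assume "0 < C" "\<forall>x\<ge>0. \<Lambda> x \<le> C powr x"
  then obtain s where s: "0 < s" "\<And>J. (\<Sum>j<J. laplace s [j]) \<le> exp (- K - 1)"
    using sum_laplace_le[of C "exp (- K - 1)"] by auto
  have "mean_early J n (1 / s * n) \<le> exp (- K * n)" for n J
  proof -
    have "mean_early J n (1 / s * n) \<le> exp (s * (1 / s * n)) * (\<Sum>j<J. laplace s [j]) ^ n"
      using s(1) by (intro mean_early_le_laplace) simp
    also have "\<dots> \<le> exp n * exp (- K - 1) ^ n"
      using s by (intro mult_mono power_mono) (auto simp: sum_nonneg laplace_nonneg)
    also have "\<dots> = exp (- K * n)" by (simp add: algebra_simps flip: exp_of_nat_mult exp_add)
    finally show ?thesis .
  qed
  then show ?thesis using s(1) by (intro exI[of _ "1 / s"]) simp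
qed

text \<open>
  One step of length at most \<open>x\<close> followed by \<open>L\<close> steps of length at most \<open>t = e / 2\<close>, where \<open>L\<close> is about
  \<open>x / t\<close>, has speed at most \<open>e\<close>. The mean number of such words is at least \<open>C powr x * q ^ L\<close>, where
  \<open>q > 0\<close> bounds the mean of a short step from below. The second factor is at least
  \<open>q * (q powr (1 / t)) powr x\<close>, so a large \<open>C\<close> compensates for it.
\<close>

lemma supercritical_at_all_speeds:
  assumes short: "\<And>t. 0 < t \<Longrightarrow> 0 < \<Lambda> t"
    and fast: "\<And>C. 0 < C \<Longrightarrow> \<exists>x\<ge>0. C powr x < \<Lambda> x" and e: "0 < e"
  shows "\<exists>n a J. 0 < n \<and> a / real n \<le> e \<and> 1 < mean_early J n a"
proof -
  define t where "t = e / 2"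
  have t: "0 < t" using e by (simp add: t_def)
  obtain J0 where J0: "0 < mean_early J0 1 t" using mean_early_1_exceeds[of t 0] short[OF t] t by auto
  define q where "q = min 1 (mean_early J0 1 t)"
  have q: "0 < q" "q \<le> 1" "q \<le> mean_early J0 1 t" using J0 by (auto simp: q_def)
  obtain x0 where x0: "0 < x0" "\<Lambda> x0 \<le> 1" using intensity_at_0[of 1] by auto
  \<comment> \<open>The second factor of \<open>C\<close> cancels \<open>q powr (x / t)\<close>. The first one cancels the \<open>q\<close> due to rounding up
      \<open>x / t\<close>, because \<open>x\<close> turns out to exceed \<open>x0\<close>.\<close>
  define C where "C = q powr (- 1 / x0) * q powr (- 1 / t)"
  have D: "1 \<le> q powr (- 1 / x0)" "1 \<le> q powr (- 1 / t)"
    using q x0(1) t powr_mono_both'[of "- 1 / x0" 0 q q] powr_mono'[of "- 1 / x0" 0 q] powr_mono'[of "- 1 / t" 0 q] by auto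
  have C: "1 \<le> C" using mult_mono[OF D] by (simp add: C_def)
  obtain x where x: "0 \<le> x" "C powr x < \<Lambda> x" using fast[of C] C by auto
  have "x0 < x"
  proof (rule ccontr)
    assume "\<not> x0 < x"
    then have "\<Lambda> x \<le> 1" using intensity_mono[of x x0] x x0 by simp
    moreover have "1 \<le> C powr x" using C x(1) by (simp add: ge_one_powr_ge_zero)
    ultimately show False using x by simp
  qed
  obtain J1 where J1: "C powr x < mean_early J1 1 x" using mean_early_1_exceeds[OF x] by blast
  define J where "J = max J0 J1"
  define L where "L = nat \<lceil>x / t\<rceil>"
  have L: "x / t \<le> L" "L \<le> x / t + 1" using t x(1) by (auto simp: L_def)
  have "1 \<le> C powr x * q ^ L"
  proof -
    have "1 = q powr (- 1 / x0 * x0) * q powr (- 1 / t * x) * q powr (x / t + 1)"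
      using q(1) x0(1) by (simp flip: powr_add)
    also have "\<dots> \<le> q powr (- 1 / x0 * x) * q powr (- 1 / t * x) * q powr L"
    proof -
      have "- 1 / x0 * x \<le> - 1 / x0 * x0" using \<open>x0 < x\<close> x0(1) by (simp add: field_simps)
      then have "q powr (- 1 / x0 * x0) \<le> q powr (- 1 / x0 * x)" using q by (intro powr_mono') auto
      moreover have "q powr (x / t + 1) \<le> q powr L" using q L(2) by (intro powr_mono') auto
      ultimately show ?thesis by (intro mult_mono) auto
    qed
    also have "\<dots> = C powr x * q ^ L"
      using q(1) by (simp add: C_def powr_mult powr_powr powr_realpow)
    finally show ?thesis .
  qed
  also have "\<dots> < mean_early J 1 x * q ^ L"
    using J1 mean_early_mono_index[of J1 J 1 x] q(1) by (intro mult_strict_right_mono) (auto simp: J_def)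
  also have "\<dots> \<le> mean_early J 1 x * mean_early J 1 t ^ L"
    using q mean_early_mono_index[of J0 J 1 t] by (intro mult_left_mono power_mono) (auto simp: J_def)
  also have "\<dots> \<le> mean_early J 1 x * mean_early J L (L * t)"
    using t by (intro mult_left_mono mean_early_power) auto
  also have "\<dots> \<le> mean_early J (1 + L) (x + L * t)" by (rule mean_early_supermultiplicative)
  finally have "1 < mean_early J (1 + L) (x + L * t)" .
  moreover have "(x + L * t) / real (1 + L) \<le> e"
  proof -
    have "x \<le> L * t" using L(1) t by (simp add: field_simps)
    then have "x + L * t \<le> 2 * (L * t)" by linarith
    also have "\<dots> \<le> e * real (1 + L)" using e by (simp add: t_def algebra_simps)
    finally show ?thesis by (simp add: pos_divide_le_eq)
  qed
  ultimately show ?thesis by (intro exI[of _ "1 + L"] exI[of _ "x + L * t"] exI[of _ J]) simp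
qed

theorem first_passage_linear:
  assumes "(\<exists>t>0. \<Lambda> t = 0) \<or> (\<exists>C>0. \<forall>x\<ge>0. \<Lambda> x \<le> C powr x)"
  shows "\<exists>\<alpha>>0. AE y in environment. (\<lambda>n. first_passage n y / n) \<longlonglongrightarrow> \<alpha>"
proof -
  from mean_early_exponentially_small[OF assms, of 0] obtain \<delta> where "0 < \<delta>"
    "\<forall>n J. 0 < n \<longrightarrow> mean_early J n (\<delta> * real n) \<le> exp (- 0 * real n)" by (elim exE conjE)
  then show ?thesis
    using two_children_within_bounded_distance by (intro first_passage_speed[of \<delta>]) auto
qed

theorem first_passage_small_prob:
  assumes "(\<exists>t>0. \<Lambda> t = 0) \<or> (\<exists>C>0. \<forall>x\<ge>0. \<Lambda> x \<le> C powr x)"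
  shows "\<exists>\<delta>>0. \<forall>n\<ge>1. prob {y \<in> space environment. \<exists>w. length w = n \<and> position w y \<le> \<delta> * n} \<le> exp (- K * n)"
proof -
  from mean_early_exponentially_small[OF assms, of K] obtain \<delta> where "0 < \<delta>"
    "\<forall>n J. 0 < n \<longrightarrow> mean_early J n (\<delta> * real n) \<le> exp (- K * real n)" by (elim exE conjE)
  then show ?thesis by (intro exI[of _ \<delta>]) (auto intro!: prob_Ex_word_le)
qed

theorem first_passage_sublinear:
  fixes e :: real
  assumes "\<not> ((\<exists>t>0. \<Lambda> t = 0) \<or> (\<exists>C>0. \<forall>x\<ge>0. \<Lambda> x \<le> C powr x))" "0 < e"
  shows "AE y in environment. eventually (\<lambda>n. first_passage n y < e * n) sequentially"
proof -
  have "0 < \<Lambda> t" if "0 < t" for t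
    using assms(1) intensity_nonneg[of t] that by fastforce
  moreover have "\<exists>x\<ge>0. C powr x < \<Lambda> x" if "0 < C" for C
    using assms(1) that by (auto simp: not_le)
  ultimately obtain n a J where "0 < n" "a / real n \<le> e / 2" "1 < mean_early J n a"
    using supercritical_at_all_speeds[of "e / 2"] assms(2) by auto
  moreover from this have "a / real n < e" using assms(2) by linarith
  ultimately show ?thesis by (intro AE_first_passage_upper)
qed

end

section \<open>The dichotomy\<close>

text \<open>
  The counting fields form an environment of independent samples, and almost surely, when every vertex has infinitely
  many particles, \<^const>\<open>min_weight\<close> is the first passage position of the resulting branching random
  walk. So the statements about that walk transfer along the map \<open>Z\<close>, whose law is the product measure.
\<close>

theorem theorem1p2:
  fixes M :: "'a measure"
    and l :: "real \<Rightarrow> real"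
    and P :: "nat list \<Rightarrow> 'a \<Rightarrow> real set"
    and T :: "'a \<Rightarrow> nat list weighted_tree"
  assumes "prob_space M"
    and l_nonneg: "\<And>x. 0 \<le> x \<Longrightarrow> 0 \<le> l x"
    and l_loc_integrable: "\<And>x. 0 \<le> x \<Longrightarrow> set_integrable lebesgue {0..x} l"
    and l_infinite: "(\<integral>\<^sup>+ x \<in> {0..}. ennreal (l x) \<partial>lebesgue) = \<infinity>"
    and P: "iid_poisson_processes M l P"
    and T: "\<And>\<omega>. T \<omega> = pwit (\<lambda>i. P i \<omega>)"
  shows
    "((\<exists>t>0. (LINT s:{0..t}|lebesgue. l s) = 0) \<or>
      (\<exists>C>0. \<forall>x\<ge>0. (LINT s:{0..x}|lebesgue. l s) \<le> C powr x)
      \<longrightarrow>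
        (\<exists>\<alpha>>0. AE \<omega> in M. (\<lambda>n. min_weight (T \<omega>) n / real n) \<longlonglongrightarrow> \<alpha>) \<and>
        (AE \<omega> in M. linear_growth (T \<omega>)) \<and>
        (\<forall>K>0. \<exists>\<delta>>0. \<forall>n\<ge>1.
            measure M {\<omega> \<in> space M. min_weight (T \<omega>) n < \<delta> * real n} \<le> exp (- K * real n)))
     \<and>
     (\<not> ((\<exists>t>0. (LINT s:{0..t}|lebesgue. l s) = 0) \<or>
         (\<exists>C>0. \<forall>x\<ge>0. (LINT s:{0..x}|lebesgue. l s) \<le> C powr x))
      \<longrightarrow> (AE \<omega> in M. \<not> linear_growth (T \<omega>)))"
proof -
  interpret M: prob_space M by fact
  define N where "N u = P (map Suc u)" for u
  define Y where "Y u \<omega> = Defs.count (N u \<omega>)" for u \<omega>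
  define \<nu> where "\<nu> = distr M count_field_space (Y [])"
  have verts: "map Suc u \<in> pwit_verts" for u by (auto simp: pwit_verts_def)
  have N: "poisson_process M l (N u)" for u
    using P verts by (simp add: iid_poisson_processes_def N_def)
  have Y [measurable]: "Y u \<in> M \<rightarrow>\<^sub>M count_field_space" for u
    using N[of u] unfolding Y_def[abs_def] by (simp add: poisson_process_def point_process_def)
  have Y_law: "distr M count_field_space (Y u) = \<nu>" for u
    using P verts[of u] verts[of "[]"] unfolding iid_poisson_processes_def \<nu>_def Y_def[abs_def] N_def
    by blast
  have Y_indep: "M.indep_vars (\<lambda>_. count_field_space) Y UNIV"
  proof -
    have "M.indep_sets (\<lambda>i. {(\<lambda>\<omega>. Defs.count (P i \<omega>)) -` A \<inter> space M |A. A \<in> sets count_field_space}) pwit_verts"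
      using P by (simp add: iid_poisson_processes_def M.indep_vars_def2)
    then have "M.indep_sets (\<lambda>i. {(\<lambda>\<omega>. Defs.count (P i \<omega>)) -` A \<inter> space M |A. A \<in> sets count_field_space}) (range (map Suc))"
      by (rule M.indep_sets_mono_index[rotated]) (use verts in auto)
    then have "M.indep_sets (\<lambda>u. {Y u -` A \<inter> space M |A. A \<in> sets count_field_space}) UNIV"
      unfolding Y_def[abs_def] N_def
      by (rule M.indep_sets_reindex) (simp add: inj_on_def inj_map_eq_map)
    then show ?thesis by (simp add: M.indep_vars_def2)
  qed
  have unbounded: "filterlim (mean_count l) at_top at_top"
    using l_nonneg l_loc_integrable l_infinite by (rule mean_count_unbounded)
  interpret \<nu>: prob_space \<nu> unfolding \<nu>_def by (rule M.prob_space_distr) measurable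
  interpret W: branching_random_walk \<nu> particle_position
  proof
    show "particle_position j \<in> borel_measurable \<nu>" for j
      unfolding \<nu>_def by simp
  qed (rule particle_position_nonneg)
  define Z where "Z \<omega> u = Y u \<omega>" for \<omega> u
  have sets_environment: "sets W.environment = sets (Pi\<^sub>M UNIV (\<lambda>_. count_field_space))"
    unfolding W.environment_def by (intro sets_PiM_cong) (auto simp: \<nu>_def)
  have Z [measurable]: "Z \<in> M \<rightarrow>\<^sub>M W.environment"
    unfolding measurable_cong_sets[OF refl sets_environment] Z_def[abs_def]
    by (rule measurable_PiM_single') (auto intro: measurable_space[OF Y])
  \<comment> \<open>Independence and equality of laws together say exactly that the fields are a sample of the product measure.\<close>
  have Z_law: "distr M W.environment Z = W.environment"
  proof -
    have "distr M (Pi\<^sub>M UNIV (\<lambda>_. count_field_space)) (\<lambda>\<omega>. \<lambda>u\<in>UNIV. Y u \<omega>) = Pi\<^sub>M UNIV (\<lambda>_. \<nu>)"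
      using M.indep_vars_iff_distr_eq_PiM[where I = UNIV and X = Y and M' = "\<lambda>_. count_field_space"] Y_indep Y_law by simp
    moreover have "distr M W.environment Z = distr M (Pi\<^sub>M UNIV (\<lambda>_. count_field_space)) Z"
      by (rule distr_cong) (auto simp: sets_environment)
    ultimately show ?thesis by (simp add: Z_def[abs_def] restrict_UNIV W.environment_def)
  qed
  have prob_Z: "W.prob {y \<in> space W.environment. A y} = measure M {\<omega> \<in> space M. A (Z \<omega>)}"
    if [measurable]: "Measurable.pred W.environment A" for A
  proof -
    have "W.prob {y \<in> space W.environment. A y} = measure (distr M W.environment Z) {y \<in> space W.environment. A y}"
      by (simp add: Z_law)
    also have "\<dots> = measure M {\<omega> \<in> space M. A (Z \<omega>)}"
      using measurable_space[OF Z] by (subst measure_distr) (auto intro!: arg_cong[where f = "measure M"])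
    finally show ?thesis .
  qed
  have AE_Z: "AE \<omega> in M. A (Z \<omega>)" if "AE y in W.environment. A y" for A
    using that by (intro AE_distrD[OF Z]) (subst Z_law)
  interpret W: branching_random_walk_intensity \<nu> particle_position "mean_count l"
  proof
    fix c :: real assume c: "0 \<le> c"
    have "W.early_prob [j] c = measure M {\<omega> \<in> space M. j < card (N [] \<omega> \<inter> {0..c})}" for j
    proof -
      have "W.early_prob [j] c = measure M {\<omega> \<in> space M. particle_position j (Y [] \<omega>) \<le> c}"
        unfolding W.early_prob_def by (subst prob_Z) (auto simp: W.position_def Z_def)
      then show ?thesis
        using poisson_particle_position_tail[OF assms(1) N unbounded] by (simp add: Y_def)
    qed
    then show "(\<lambda>j. W.early_prob [j] c) sums mean_count l c"
      using poisson_tail_probs_sum[OF assms(1) N c] mean_count_nonneg[OF l_nonneg] by simp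
  next
    show "\<exists>h>0. mean_count l h \<le> e" if "0 < e" for e
      using l_loc_integrable that by (rule mean_count_at_0)
    show "\<exists>c>0. r \<le> mean_count l c" for r
    proof -
      have "eventually (\<lambda>c. r \<le> mean_count l c \<and> 0 < c) at_top"
        using unbounded by (auto simp: filterlim_at_top intro!: eventually_conj eventually_gt_at_top)
      then show ?thesis by (auto simp: eventually_at_top_linorder)
    qed
  qed
  have min_weight: "AE \<omega> in M. \<forall>n. min_weight (T \<omega>) n = W.first_passage n (Z \<omega>)"
  proof -
    have "AE \<omega> in M. \<forall>u. infinite (N u \<omega>)"
      using AE_infinite_particles[OF assms(1) N unbounded] by (simp add: AE_all_countable)
    then show ?thesis
    proof (rule AE_mp, intro AE_I2 impI allI)
      fix \<omega> n assume \<omega>: "\<omega> \<in> space M" "\<forall>u. infinite (N u \<omega>)"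
      have "particle_position j (Z \<omega> u) = nth_particle (P (map Suc u) \<omega>) (Suc j)" for j u
        using particle_position_count[OF poisson_particles[OF N \<omega>(1)] \<omega>(2)[rule_format]]
        by (simp add: Z_def Y_def N_def)
      then show "min_weight (T \<omega>) n = W.first_passage n (Z \<omega>)"
        by (simp add: T min_weight_pwit W.first_passage_def W.position_def)
    qed
  qed
  let ?C = "(\<exists>t>0. mean_count l t = 0) \<or> (\<exists>C>0. \<forall>x\<ge>0. mean_count l x \<le> C powr x)"
  have "(\<exists>\<alpha>>0. AE \<omega> in M. (\<lambda>n. min_weight (T \<omega>) n / real n) \<longlonglongrightarrow> \<alpha>) \<and>
        (AE \<omega> in M. linear_growth (T \<omega>)) \<and>
        (\<forall>K>0. \<exists>\<delta>>0. \<forall>n\<ge>1.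
            measure M {\<omega> \<in> space M. min_weight (T \<omega>) n < \<delta> * real n} \<le> exp (- K * real n))" if C: ?C
  proof (intro conjI allI impI)
    obtain \<alpha> where \<alpha>: "0 < \<alpha>" "AE y in W.environment. (\<lambda>n. W.first_passage n y / n) \<longlonglongrightarrow> \<alpha>"
      using W.first_passage_linear[OF C] by blast
    have lim: "AE \<omega> in M. (\<lambda>n. min_weight (T \<omega>) n / n) \<longlonglongrightarrow> \<alpha>"
      using AE_Z[OF \<alpha>(2)] min_weight by eventually_elim simp
    then show "\<exists>\<alpha>>0. AE \<omega> in M. (\<lambda>n. min_weight (T \<omega>) n / real n) \<longlonglongrightarrow> \<alpha>"
      using \<alpha>(1) by blast
    show "AE \<omega> in M. linear_growth (T \<omega>)"
      using lim
    proof eventually_elim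
      case (elim \<omega>)
      then have "(\<lambda>n. ereal (min_weight (T \<omega>) n / n)) \<longlonglongrightarrow> ereal \<alpha>" by simp
      then have "liminf (\<lambda>n. ereal (min_weight (T \<omega>) n / n)) = ereal \<alpha>"
        by (intro lim_imp_Liminf) simp_all
      then show ?case using \<alpha>(1) by (simp add: linear_growth_def)
    qed
    fix K :: real
    from W.first_passage_small_prob[OF C, of K] obtain \<delta> where \<delta>: "0 < \<delta>"
      "\<forall>n\<ge>1. W.prob {y \<in> space W.environment. \<exists>w. length w = n \<and> W.position w y \<le> \<delta> * real n} \<le> exp (- K * real n)"
      by (elim exE conjE)
    have "measure M {\<omega> \<in> space M. min_weight (T \<omega>) n < \<delta> * n} \<le> exp (- K * n)" if n: "1 \<le> n" for n
    proof -
      have "measure M {\<omega> \<in> space M. min_weight (T \<omega>) n < \<delta> * n}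
          \<le> measure M {\<omega> \<in> space M. \<exists>w. length w = n \<and> W.position w (Z \<omega>) \<le> \<delta> * n}"
      proof (rule M.finite_measure_mono_AE)
        show "AE \<omega> in M. \<omega> \<in> {\<omega> \<in> space M. min_weight (T \<omega>) n < \<delta> * n} \<longrightarrow>
            \<omega> \<in> {\<omega> \<in> space M. \<exists>w. length w = n \<and> W.position w (Z \<omega>) \<le> \<delta> * n}"
          using min_weight
        proof eventually_elim
          case (elim \<omega>)
          have "\<exists>w. length w = n \<and> W.position w (Z \<omega>) \<le> \<delta> * n" if "W.first_passage n (Z \<omega>) < \<delta> * n"
          proof (rule ccontr)
            assume none: "\<not> (\<exists>w. length w = n \<and> W.position w (Z \<omega>) \<le> \<delta> * n)"
            have "\<delta> * n \<le> W.position w (Z \<omega>)" if "length w = n" for w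
            proof -
              have "\<not> W.position w (Z \<omega>) \<le> \<delta> * n" using none that by auto
              then show ?thesis by linarith
            qed
            then have "\<delta> * n \<le> W.first_passage n (Z \<omega>)" by (rule W.first_passage_greatest)
            then show False using that by linarith
          qed
          then show ?case using elim by auto
        qed
      qed measurable
      also have "\<dots> = W.prob {y \<in> space W.environment. \<exists>w. length w = n \<and> W.position w y \<le> \<delta> * n}"
        by (rule prob_Z[symmetric]) measurable
      finally show ?thesis using \<delta>(2) n by fastforce
    qed
    then show "\<exists>\<delta>>0. \<forall>n\<ge>1. measure M {\<omega> \<in> space M. min_weight (T \<omega>) n < \<delta> * real n} \<le> exp (- K * real n)"
      using \<delta>(1) by blast
  qed
  moreover have "AE \<omega> in M. \<not> linear_growth (T \<omega>)" if C: "\<not> ?C"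
  proof -
    have "AE y in W.environment. \<forall>i. eventually (\<lambda>n. W.first_passage n y < 1 / real (Suc i) * n) sequentially"
      unfolding AE_all_countable by (intro allI W.first_passage_sublinear[OF C]) simp
    from AE_Z[OF this] min_weight show ?thesis
    proof eventually_elim
      case (elim \<omega>)
      let ?L = "liminf (\<lambda>n. ereal (min_weight (T \<omega>) n / real n))"
      have L_le: "?L \<le> ereal (1 / real (Suc i))" for i
      proof -
        have "eventually (\<lambda>n. ereal (min_weight (T \<omega>) n / n) \<le> ereal (1 / real (Suc i))) sequentially"
          using elim(1)[rule_format, of i] eventually_gt_at_top[of 0]
        proof eventually_elim
          case (elim n)
          then have "min_weight (T \<omega>) n < 1 / real (Suc i) * n"
            using \<open>\<forall>n. min_weight (T \<omega>) n = W.first_passage n (Z \<omega>)\<close> by simp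
          then have "min_weight (T \<omega>) n / n < 1 / real (Suc i)"
            using elim(2) by (simp only: pos_divide_less_eq of_nat_0_less_iff)
          then show ?case by (simp only: ereal_less_eq less_imp_le)
        qed
        then show ?thesis by (intro order_trans[OF Liminf_le_Limsup] Limsup_bounded) simp_all
      qed
      show ?case
      proof
        assume "linear_growth (T \<omega>)"
        then have "0 < ?L" by (simp add: linear_growth_def)
        then obtain z where z: "0 < ereal z" "ereal z < ?L" using ereal_dense2 by blast
        from z(1) have "0 < z" by simp
        then obtain i where "1 / real (Suc i) < z" using nat_approx_posE by blast
        then have "ereal (1 / real (Suc i)) < ?L" using z(2) by (meson ereal_less(1) less_ereal.simps(1) less_trans)
        then show False using L_le[of i] by (simp add: not_le[symmetric])
      qed
    qed
  qed
  ultimately show ?thesis unfolding mean_count_def by blast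
qed

end
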